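(* Let $0<\beta<1$, $0<\alpha<n$ with $\alpha+\beta<n$, $1<p<n/(\alpha+\beta)$, $1/s=1/p-(\alpha+\beta)/n$, $0<\kappa<\min\{p/s,p\beta/n\}$, and let $w$ be a weight with $w^s\in A_1$. If $b\in Lip_\beta(\mathbb R^n)$, then $[b,I_\alpha]$ is bounded from $L^{p,\kappa}(w^p,w^s)$ to $L^{s,\kappa s/p}(w^s)$; that is, there is $C$ independent of $f$ with $$\|[b,I_\alpha]f\|_{L^{s,\kappa s/p}(w^s)}\le C\|b\|_{Lip_\beta}\|f\|_{L^{p,\kappa}(w^p,w^s)}.$$
   Context: All cubes have sides parallel to the axes. A weight is a locally integrable function on $\mathbb R^n$ that is positive a.e.; for a weight $u$ and a cube $Q$, $u(Q)=\int_Q u(x)\,dx$ (so e.g. $w^s(Q)=\int_Q w^s$). $w\in A_1$ means $\frac1{|Q|}\int_Q w\le C\,\mathrm{ess\,inf}_Q w$ for all cubes $Q$. The fractional integral is $I_\alpha f(x)=c_{n,\alpha}\int_{\mathbb R^n}\frac{f(y)}{|x-y|^{n-\alpha}}dy$ ($0<\alpha<n$, $c_{n,\alpha}>0$ a normalizing constant), and for locally integrable $b$, $[b,I_\alpha]f(x)=b(x)I_\alpha f(x)-I_\alpha(bf)(x)$. For $0<\beta<1$, with $b_Q=\frac1{|Q|}\int_Q b$, $\|b\|_{Lip_\beta}=\sup_Q\frac{1}{|Q|^{\beta/n}}\frac1{|Q|}\int_Q|b(x)-b_Q|\,dx$ and $Lip_\beta(\mathbb R^n)$ is the set of $b$ with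 this finite. For $1\le p<\infty$, $0<\kappa<1$ and weights $u,v$, the weighted Morrey space $L^{p,\kappa}(u,v)$ consists of $f\in L^p_{loc}(u)$ with $\|f\|_{L^{p,\kappa}(u,v)}=\sup_Q\big(\frac1{v(Q)^\kappa}\int_Q|f|^pu\big)^{1/p}<\infty$, and $L^{p,\kappa}(w)=L^{p,\kappa}(w,w)$. *)

theory Defs
  imports "HOL-Analysis.Analysis"
begin

text \<open>Cubes with sides parallel to the axes (closed; boundaries are null sets).\<close>
definition cube :: "'a::euclidean_space set \<Rightarrow> bool" where
  "cube Q \<longleftrightarrow> (\<exists>x h. h > 0 \<and> Q = cbox x (x + h *\<^sub>R One))"

text \<open>Locally integrable: integrable on every cube (equivalently on every compact set).\<close>
definition loc_int :: "('a::euclidean_space \<Rightarrow> real) \<Rightarrow> bool" where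
  "loc_int u \<longleftrightarrow> u \<in> borel_measurable lebesgue \<and>
     (\<forall>Q. cube Q \<longrightarrow> set_integrable lebesgue Q u)"

definition weight :: "('a::euclidean_space \<Rightarrow> real) \<Rightarrow> bool" where
  "weight u \<longleftrightarrow> loc_int u \<and> (AE x in lebesgue. 0 < u x)"

definition wmeas :: "('a::euclidean_space \<Rightarrow> real) \<Rightarrow> 'a set \<Rightarrow> real" where
  "wmeas u Q = (LINT x:Q|lebesgue. u x)"

definition avg :: "('a::euclidean_space \<Rightarrow> real) \<Rightarrow> 'a set \<Rightarrow> real" where
  "avg u Q = wmeas u Q / measure lebesgue Q"

definition ess_inf_on :: "'a::euclidean_space set \<Rightarrow> ('a \<Rightarrow> real) \<Rightarrow> real" where
  "ess_inf_on Q u = Sup {t. AE x in lebesgue. x \<in> Q \<longrightarrow> t \<le> u x}"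

definition A1 :: "('a::euclidean_space \<Rightarrow> real) \<Rightarrow> bool" where
  "A1 u \<longleftrightarrow> weight u \<and> (\<exists>C. \<forall>Q. cube Q \<longrightarrow> avg u Q \<le> C * ess_inf_on Q u)"

definition frac_int :: "real \<Rightarrow> real \<Rightarrow> ('a::euclidean_space \<Rightarrow> real) \<Rightarrow> 'a \<Rightarrow> real" where
  "frac_int c \<alpha> f x = c * (LINT y|lebesgue. f y / norm (x - y) powr (real DIM('a) - \<alpha>))"

definition commutator :: "('a::euclidean_space \<Rightarrow> real) \<Rightarrow> real \<Rightarrow> real \<Rightarrow> ('a \<Rightarrow> real) \<Rightarrow> 'a \<Rightarrow> real" where
  "commutator b c \<alpha> f x = b x * frac_int c \<alpha> f x - frac_int c \<alpha> (\<lambda>y. b y * f y) x"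

definition lip_osc :: "real \<Rightarrow> ('a::euclidean_space \<Rightarrow> real) \<Rightarrow> 'a set \<Rightarrow> real" where
  "lip_osc \<beta> b Q = 1 / (measure lebesgue Q powr (\<beta> / real DIM('a)))
      * (1 / measure lebesgue Q) * (LINT x:Q|lebesgue. \<bar>b x - avg b Q\<bar>)"

definition lip_space :: "real \<Rightarrow> ('a::euclidean_space \<Rightarrow> real) \<Rightarrow> bool" where
  "lip_space \<beta> b \<longleftrightarrow> loc_int b \<and> bdd_above (lip_osc \<beta> b ` Collect cube)"

definition lip_norm :: "real \<Rightarrow> ('a::euclidean_space \<Rightarrow> real) \<Rightarrow> real" where
  "lip_norm \<beta> b = (SUP Q\<in>Collect cube. lip_osc \<beta> b Q)"

definition morrey_quot :: "real \<Rightarrow> real \<Rightarrow> ('a::euclidean_space \<Rightarrow> real) \<Rightarrow> ('a \<Rightarrow> real)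
    \<Rightarrow> ('a \<Rightarrow> real) \<Rightarrow> 'a set \<Rightarrow> real" where
  "morrey_quot p \<kappa> u v f Q =
     (1 / (wmeas v Q powr \<kappa>) * (LINT x:Q|lebesgue. \<bar>f x\<bar> powr p * u x)) powr (1 / p)"

definition morrey_space :: "real \<Rightarrow> real \<Rightarrow> ('a::euclidean_space \<Rightarrow> real) \<Rightarrow> ('a \<Rightarrow> real)
    \<Rightarrow> ('a \<Rightarrow> real) \<Rightarrow> bool" where
  "morrey_space p \<kappa> u v f \<longleftrightarrow> f \<in> borel_measurable lebesgue \<and>
     (\<forall>Q. cube Q \<longrightarrow> set_integrable lebesgue Q (\<lambda>x. \<bar>f x\<bar> powr p * u x)) \<and>
     bdd_above (morrey_quot p \<kappa> u v f ` Collect cube)"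

definition morrey_norm :: "real \<Rightarrow> real \<Rightarrow> ('a::euclidean_space \<Rightarrow> real) \<Rightarrow> ('a \<Rightarrow> real)
    \<Rightarrow> ('a \<Rightarrow> real) \<Rightarrow> real" where
  "morrey_norm p \<kappa> u v f = (SUP Q\<in>Collect cube. morrey_quot p \<kappa> u v f Q)"

end

theory Submission
  imports Defs
begin

text \<open>
  By Campanato's characterisation \<open>b\<close> is almost everywhere Hoelder continuous, so the commutator is
  dominated by \<open>\<parallel>b\<parallel> I\<^bsub>\<gamma>\<^esub>\<bar>f\<bar>\<close> with \<open>\<gamma> = \<alpha> + \<beta>\<close>. Put \<open>u = w\<^bsup>s\<^esup>\<close>, \<open>d\<mu> = u dx\<close> and
  \<open>\<psi>(x,y) = \<bar>x - y\<bar>\<^bsup>n\<^esup> u(y)\<close>, with the supremum norm. The \<open>A\<^sub>1\<close> condition says that for almost every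
  \<open>y\<close> the cubes centred at \<open>x\<close> and at \<open>y\<close> with radius \<open>\<bar>x - y\<bar>\<close> have \<open>\<mu>\<close>-mass at most
  \<open>C \<psi>(x,y)\<close>. Hence \<open>\<mu>{\<psi> < t} \<le> C t\<close> in each variable, and the Morrey condition gives
  \<open>\<nu>{\<psi>(x,\<cdot>) < t} \<le> C t\<^bsup>\<kappa>\<^esup>\<close> for \<open>d\<nu> = \<bar>f\<bar>\<^bsup>p\<^esup> w\<^bsup>p\<^esup> dx\<close>. With \<open>\<bar>f\<bar> = h u\<^bsup>\<gamma>/n\<^esup>\<close> the potential becomes
  \<open>\<integral> h \<psi>\<^bsup>\<gamma>/n - 1\<^esup> d\<mu>\<close>. Far from a cube, Hoelder's inequality and these growth bounds suffice.
  Near the cube a threefold Hoelder inequality followed by Tonelli suffices, because \<open>\<kappa> > 0\<close> leaves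
  room in the exponents; neither a maximal function nor interpolation is needed.
\<close>

section \<open>Hoelder inequalities and dyadic shells\<close>

text \<open>The obstacle is a borderline one. In the local estimate the kernel is h
  \<psi>^(-\<theta>) with \<theta> = 1/s + 1/p', and a splitting into the powers 1/s, 1/p - 1/s and
  1/p' already balances when \<psi> has exponent 1 in the outer factors and 0 in the middle one. But
  with mass growth of order t the dyadic bound for the integral of 1/\<psi> diverges
  logarithmically. The growth t^\<kappa> of the Morrey measure lets the middle factor absorb a small
  exponent e < \<kappa>, which lowers the outer exponent below 1. At infinity the corresponding
  slack is 1/s - \<kappa>/p. Since \<psi>(x,y) contains u at y alone, a single exceptional set of
  points y serves cubes about both points, and the two growth bounds hold for every x and for almost
  every y respectively. Potentials may a priori be infinite, so s-th powers are taken of finite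
  numbers below them; Morrey bounds are kept strictly positive, and the norm is reached by a
  limit.\<close>

lemma Youngs_inequality_nonneg:
  fixes x y :: real
  assumes "0 < a" "0 < b" "a + b = 1" "0 \<le> x" "0 \<le> y"
  shows "x powr a * y powr b \<le> a * x + b * y"
proof (cases "x = 0 \<or> y = 0")
  case True
  then show ?thesis using assms by auto
next
  case False
  then show ?thesis using assms by (intro Youngs_inequality_0) auto
qed

text \<open>Merging the last two terms into one of weight \<open>m = l2 + l3\<close> leaves two uses
  of the two-term inequality.\<close>

lemma weighted_am_gm3:
  fixes x y z :: real
  assumes l: "0 < l1" "0 < l2" "0 < l3" "l1 + l2 + l3 = 1"
    and nn: "0 \<le> x" "0 \<le> y" "0 \<le> z"
  shows "x powr l1 * y powr l2 * z powr l3 \<le> l1 * x + l2 * y + l3 * z"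
proof -
  define m where "m = 1 - l1"
  have m: "0 < m" "m = l2 + l3"
    using l by (auto simp: m_def)
  then have "l2 / m + l3 / m = 1" by (simp add: add_divide_distrib[symmetric])
  note m = m this
  define v where "v = y powr (l2 / m) * z powr (l3 / m)"
  have "v \<le> l2 / m * y + l3 / m * z"
    unfolding v_def by (rule Youngs_inequality_nonneg) (use l m nn in auto)
  then have v: "m * v \<le> l2 * y + l3 * z"
    using m(1) by (simp add: field_simps)
  have "x powr l1 * v powr m \<le> l1 * x + m * v"
    by (rule Youngs_inequality_nonneg) (use l m nn in \<open>auto simp: m_def v_def\<close>)
  moreover have "v powr m = y powr l2 * z powr l3"
    using m(1) nn by (simp add: v_def powr_mult powr_powr)
  ultimately show ?thesis
    using v by (simp add: mult.assoc)
qed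

text \<open>Normalise each function by the bound on its integral, apply the weighted mean inequality
  pointwise and integrate; the weights sum to 1. Upper bounds \<open>A\<close>, \<open>B\<close>,
  \<open>D\<close> stand in for the integrals because one divides by them and an integral may
  vanish.\<close>

lemma nn_integral_Holder3:
  fixes X Y Z :: "'b \<Rightarrow> real"
  assumes l: "0 < l1" "0 < l2" "0 < l3" "l1 + l2 + l3 = 1"
    and [measurable]: "X \<in> borel_measurable M" "Y \<in> borel_measurable M" "Z \<in> borel_measurable M"
    and nn: "\<And>x. 0 \<le> X x" "\<And>x. 0 \<le> Y x" "\<And>x. 0 \<le> Z x"
    and pos: "0 < A" "0 < B" "0 < D"
    and le: "(\<integral>\<^sup>+x. X x \<partial>M) \<le> ennreal A" "(\<integral>\<^sup>+x. Y x \<partial>M) \<le> ennreal B"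
      "(\<integral>\<^sup>+x. Z x \<partial>M) \<le> ennreal D"
  shows "(\<integral>\<^sup>+x. ennreal (X x powr l1 * Y x powr l2 * Z x powr l3) \<partial>M)
    \<le> ennreal (A powr l1 * B powr l2 * D powr l3)"
proof -
  define K where "K = A powr l1 * B powr l2 * D powr l3"
  have K: "0 < K" using pos by (simp add: K_def)
  have pw: "X x powr l1 * Y x powr l2 * Z x powr l3
      \<le> (K * l1 / A) * X x + (K * l2 / B) * Y x + (K * l3 / D) * Z x" for x
  proof -
    have "(X x / A) powr l1 * (Y x / B) powr l2 * (Z x / D) powr l3
        \<le> l1 * (X x / A) + l2 * (Y x / B) + l3 * (Z x / D)"
      by (rule weighted_am_gm3) (use l nn pos in auto)
    then have "K * ((X x / A) powr l1 * (Y x / B) powr l2 * (Z x / D) powr l3)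
        \<le> K * (l1 * (X x / A) + l2 * (Y x / B) + l3 * (Z x / D))"
      using K by (simp add: mult_left_mono)
    moreover have "K * ((X x / A) powr l1 * (Y x / B) powr l2 * (Z x / D) powr l3)
        = X x powr l1 * Y x powr l2 * Z x powr l3"
      using nn pos by (simp add: K_def powr_divide)
    ultimately show ?thesis by (simp add: algebra_simps)
  qed
  have "(\<integral>\<^sup>+x. ennreal (X x powr l1 * Y x powr l2 * Z x powr l3) \<partial>M)
      \<le> (\<integral>\<^sup>+x. (ennreal (K * l1 / A) * X x + ennreal (K * l2 / B) * Y x)
            + ennreal (K * l3 / D) * Z x \<partial>M)"
    using pw K l pos nn
    by (intro nn_integral_mono) (simp add: ennreal_mult'[symmetric] ennreal_plus[symmetric] del: ennreal_plus)
  also have "\<dots> = (ennreal (K * l1 / A) * (\<integral>\<^sup>+x. X x \<partial>M) + ennreal (K * l2 / B) * (\<integral>\<^sup>+x. Y x \<partial>M))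
            + ennreal (K * l3 / D) * (\<integral>\<^sup>+x. Z x \<partial>M)"
    by (simp add: nn_integral_add nn_integral_cmult)
  also have "\<dots> \<le> (ennreal (K * l1 / A) * ennreal A + ennreal (K * l2 / B) * ennreal B)
            + ennreal (K * l3 / D) * ennreal D"
    by (intro add_mono mult_left_mono le) auto
  also have "\<dots> = ennreal (K * l1 / A * A + K * l2 / B * B + K * l3 / D * D)"
    using K l pos by (simp add: ennreal_mult'[symmetric] ennreal_plus[symmetric] del: ennreal_plus)
  also have "K * l1 / A * A + K * l2 / B * B + K * l3 / D * D = K * (l1 + l2 + l3)"
    using pos by (simp add: algebra_simps)
  finally show ?thesis using l by (simp add: K_def)
qed

text \<open>The second exponent is cut into two equal halves, so that the threefold inequality
  applies.\<close>

lemma nn_integral_Holder: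
  fixes X Y :: "'b \<Rightarrow> real"
  assumes l: "0 < l1" "0 < l2" "l1 + l2 = 1"
    and M: "X \<in> borel_measurable M" "Y \<in> borel_measurable M"
    and nn: "\<And>x. 0 \<le> X x" "\<And>x. 0 \<le> Y x"
    and pos: "0 < A" "0 < B"
    and le: "(\<integral>\<^sup>+x. X x \<partial>M) \<le> ennreal A" "(\<integral>\<^sup>+x. Y x \<partial>M) \<le> ennreal B"
  shows "(\<integral>\<^sup>+x. ennreal (X x powr l1 * Y x powr l2) \<partial>M) \<le> ennreal (A powr l1 * B powr l2)"
proof -
  have "(\<integral>\<^sup>+x. ennreal (X x powr l1 * Y x powr (l2/2) * Y x powr (l2/2)) \<partial>M)
    \<le> ennreal (A powr l1 * B powr (l2/2) * B powr (l2/2))"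
    by (rule nn_integral_Holder3) (use assms in auto)
  then show ?thesis by (simp add: mult.assoc powr_add[symmetric])
qed

text \<open>The integral of \<open>X\<close> stays on the right unestimated: \<open>X\<close> will
  depend on a further variable and be integrated in it afterwards. The integral of the product may
  be infinite, so its s-th power enters through the finite numbers \<open>t\<close> below
  it.\<close>

lemma Holder3_powr:
  fixes X Y Z :: "'b \<Rightarrow> real"
  assumes l: "1 < s" "0 < l2" "0 < l3" "1 / s + l2 + l3 = 1"
    and meas: "X \<in> borel_measurable M" "Y \<in> borel_measurable M" "Z \<in> borel_measurable M"
    and nn: "\<And>x. 0 \<le> X x" "\<And>x. 0 \<le> Y x" "\<And>x. 0 \<le> Z x"
    and pos: "0 < B" "0 < D" and t: "0 \<le> t"
    and le: "(\<integral>\<^sup>+x. Y x \<partial>M) \<le> ennreal B" "(\<integral>\<^sup>+x. Z x \<partial>M) \<le> ennreal D"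
    and t_le: "ennreal t \<le> (\<integral>\<^sup>+x. ennreal (X x powr (1 / s) * Y x powr l2 * Z x powr l3) \<partial>M)"
  shows "ennreal (t powr s) \<le> ennreal (B powr (l2 * s) * D powr (l3 * s)) * (\<integral>\<^sup>+x. X x \<partial>M)"
proof (cases "(\<integral>\<^sup>+x. X x \<partial>M) = \<infinity>")
  case True
  then show ?thesis using pos by (simp add: ennreal_mult_top)
next
  case False
  define a where "a = enn2real (\<integral>\<^sup>+x. X x \<partial>M)"
  have a: "(\<integral>\<^sup>+x. X x \<partial>M) = ennreal a" "0 \<le> a"
    using False by (auto simp: a_def less_top)
  \<comment> \<open>The integral of \<open>X\<close> may be 0 while the inequality wants a positive
    bound; hence \<open>a + e\<close>, with \<open>e\<close> tending to 0 afterwards.\<close>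
  have K: "t powr s \<le> (a + e) * (B powr (l2 * s) * D powr (l3 * s))" if e: "0 < e" for e
  proof -
    have "ennreal t \<le> ennreal ((a + e) powr (1 / s) * B powr l2 * D powr l3)"
      by (rule order_trans[OF t_le nn_integral_Holder3])
         (use a e l meas nn pos le in \<open>auto intro!: ennreal_leI\<close>)
    then have "t \<le> (a + e) powr (1 / s) * B powr l2 * D powr l3"
      using a e by (subst (asm) ennreal_le_iff) auto
    then have "t powr s \<le> ((a + e) powr (1 / s) * B powr l2 * D powr l3) powr s"
      using l t by (intro powr_mono2) auto
    also have "\<dots> = (a + e) * (B powr (l2 * s) * D powr (l3 * s))"
      using a e l by (simp add: powr_mult powr_powr mult.assoc)
    finally show ?thesis .
  qed
  have "t powr s \<le> a * (B powr (l2 * s) * D powr (l3 * s)) + e" if e: "0 < e" for e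
  proof -
    define k where "k = B powr (l2 * s) * D powr (l3 * s)"
    have "0 < k" using pos by (simp add: k_def)
    then show ?thesis
      using K[of "e / k"] e unfolding k_def[symmetric]
      by (simp add: ring_distribs)
  qed
  then have "t powr s \<le> a * (B powr (l2 * s) * D powr (l3 * s))"
    by (rule field_le_epsilon)
  then show ?thesis
    using a by (simp add: a ennreal_mult'[symmetric] ennreal_leI mult.commute)
qed

section \<open>Integrals of negative powers over dyadic shells\<close>

lemma dyadic_scale_below:
  fixes U v :: real
  assumes "0 < v" "v < U"
  shows "\<exists>j::nat. U / 2 ^ Suc j \<le> v \<and> v < U / 2 ^ j"
proof -
  define P where "P j \<longleftrightarrow> U / 2 ^ Suc j \<le> v" for j :: nat
  obtain m :: nat where "U / v < 2 ^ m"
    using real_arch_pow[of 2 "U / v"] by auto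
  then have "P m"
    using assms by (simp add: P_def field_simps)
  then have "P (LEAST j. P j)" by (rule LeastI)
  moreover have "v < U / 2 ^ (LEAST j. P j)"
  proof (cases "LEAST j. P j")
    case 0
    then show ?thesis using assms by simp
  next
    case (Suc k)
    then have "\<not> P k" by (metis not_less_Least lessI)
    then show ?thesis using Suc by (simp add: P_def)
  qed
  ultimately show ?thesis unfolding P_def by blast
qed

lemma dyadic_scale_above:
  fixes T v :: real
  assumes "0 < T" "T \<le> v"
  shows "\<exists>j::nat. T * 2 ^ j \<le> v \<and> v < T * 2 ^ Suc j"
proof -
  define P where "P j \<longleftrightarrow> v < T * 2 ^ Suc j" for j :: nat
  obtain m :: nat where "v / T < 2 ^ m"
    using real_arch_pow[of 2 "v / T"] by auto
  then have "P m"
    using assms by (simp add: P_def field_simps)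
  then have "P (LEAST j. P j)" by (rule LeastI)
  moreover have "T * 2 ^ (LEAST j. P j) \<le> v"
  proof (cases "LEAST j. P j")
    case 0
    then show ?thesis using assms by simp
  next
    case (Suc k)
    then have "\<not> P k" by (metis not_less_Least lessI)
    then show ?thesis using Suc by (simp add: P_def)
  qed
  ultimately show ?thesis unfolding P_def by blast
qed

text \<open>On the shell between \<open>U / 2 ^ Suc j\<close> and \<open>U / 2 ^ j\<close> the
  integrand is at most its value at the lower end, and the mass is at most \<open>K\<close> times
  the k-th power of the upper end; the resulting series has ratio 2^(b-k) < 1. The mass of
  \<open>E\<close> enters only where \<psi> is at least \<open>U\<close>.\<close>

lemma nn_integral_negative_power_near:
  fixes \<psi> :: "'b \<Rightarrow> real"
  assumes \<psi>[measurable]: "\<psi> \<in> borel_measurable M" and E[measurable]: "E \<in> sets M"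
    and nn: "\<And>y. 0 \<le> \<psi> y" and b: "0 \<le> b" "b < k" and K: "0 \<le> K" and U: "0 < U"
    and sub: "\<And>t. 0 < t \<Longrightarrow> emeasure M {y \<in> space M. \<psi> y < t} \<le> ennreal (K * t powr k)"
    and EU: "emeasure M E \<le> ennreal (K * U powr k)"
  shows "(\<integral>\<^sup>+y\<in>E. ennreal (\<psi> y powr (- b)) \<partial>M)
    \<le> ennreal ((1 + 2 powr b / (1 - 2 powr (b - k))) * K * U powr (k - b))"
proof -
  define c where "c = (\<lambda>j::nat. (U / 2 ^ Suc j) powr (- b))"
  define q where "q = 2 powr (b - k)"
  have q: "0 < q" "q < 1" using b by (auto simp: q_def powr_less_one)
  have pw: "ennreal (\<psi> y powr (- b)) * indicator E y \<le> ennreal (U powr (- b)) * indicator E y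
      + (\<Sum>j. ennreal (c j) * indicator {y \<in> space M. \<psi> y < U / 2 ^ j} y)"
    if y: "y \<in> space M" for y
  proof -
    consider "\<psi> y = 0" | "U \<le> \<psi> y" | "0 < \<psi> y" "\<psi> y < U"
      using nn[of y] by linarith
    then show ?thesis
    proof cases
      \<comment> \<open>In HOL \<open>0 powr (- b)\<close> is 0, so the zero set of \<psi>
        contributes nothing.\<close>
      case 1 then show ?thesis by simp
    next
      case 2
      then have "\<psi> y powr (- b) \<le> U powr (- b)"
        using U b by (intro powr_mono2') auto
      then show ?thesis
        by (intro add_increasing2 mult_right_mono ennreal_leI) auto
    next
      case 3
      then obtain j :: nat where j: "U / 2 ^ Suc j \<le> \<psi> y" "\<psi> y < U / 2 ^ j"
        using dyadic_scale_below by blast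
      have "ennreal (\<psi> y powr (- b)) * indicator E y \<le> ennreal (c j) * 1"
        unfolding c_def using j b U
        by (intro mult_mono ennreal_leI powr_mono2') (auto simp: indicator_def)
      also have "\<dots> = (\<Sum>i\<in>{j}. ennreal (c i) * indicator {y \<in> space M. \<psi> y < U / 2 ^ i} y)"
        using j y by simp
      also have "\<dots> \<le> (\<Sum>i. ennreal (c i) * indicator {y \<in> space M. \<psi> y < U / 2 ^ i} y)"
        by (intro sum_le_suminf) auto
      finally show ?thesis by (intro add_increasing) auto
    qed
  qed
  have summand: "c j * (K * (U / 2 ^ j) powr k) = 2 powr b * K * U powr (k - b) * q ^ j" for j
  proof -
    have 1: "(U / 2 ^ j) powr k = U powr k * 2 powr (- (real j * k))"
      using U by (simp add: powr_divide powr_realpow[symmetric] powr_powr powr_minus field_simps)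
    have 2: "c j = U powr (- b) * (2 powr b * 2 powr (real j * b))"
      using U by (simp add: c_def powr_divide powr_realpow[symmetric] powr_powr powr_minus powr_add
          field_simps powr_mult)
    have 3: "q ^ j = 2 powr (real j * b) * 2 powr (- (real j * k))"
      by (simp add: q_def powr_realpow[symmetric] powr_powr powr_add[symmetric] algebra_simps)
    have 4: "U powr (k - b) = U powr k * U powr (- b)"
      by (simp add: powr_add[symmetric])
    show ?thesis unfolding 1 2 3 4 by (simp add: algebra_simps)
  qed
  have "(\<integral>\<^sup>+y\<in>E. ennreal (\<psi> y powr (- b)) \<partial>M) \<le> (\<integral>\<^sup>+y. ennreal (U powr (- b)) * indicator E y
      + (\<Sum>j. ennreal (c j) * indicator {y \<in> space M. \<psi> y < U / 2 ^ j} y) \<partial>M)"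
    by (intro nn_integral_mono pw)
  also have "\<dots> = ennreal (U powr (- b)) * emeasure M E
      + (\<Sum>j. ennreal (c j) * emeasure M {y \<in> space M. \<psi> y < U / 2 ^ j})"
    by (simp add: nn_integral_add nn_integral_suminf nn_integral_cmult)
  also have "\<dots> \<le> ennreal (U powr (- b)) * ennreal (K * U powr k)
      + (\<Sum>j. ennreal (c j) * ennreal (K * (U / 2 ^ j) powr k))"
    using U by (intro add_mono mult_left_mono suminf_le sub EU) auto
  also have "(\<Sum>j. ennreal (c j) * ennreal (K * (U / 2 ^ j) powr k))
      = (\<Sum>j. ennreal (2 powr b * K * U powr (k - b) * q ^ j))"
    by (intro suminf_cong) (simp only: summand ennreal_mult''[symmetric] K powr_ge_zero mult_nonneg_nonneg)
  also have "\<dots> = ennreal (2 powr b * K * U powr (k - b) * (1 / (1 - q)))"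
  proof -
    have "(\<lambda>j. 2 powr b * K * U powr (k - b) * q ^ j) sums (2 powr b * K * U powr (k - b) * (1 / (1 - q)))"
      by (intro sums_mult geometric_sums) (use q in auto)
    then show ?thesis using K q by (intro suminf_ennreal_eq) auto
  qed
  also have "ennreal (U powr (- b)) * ennreal (K * U powr k) = ennreal (K * U powr (k - b))"
    using K by (simp add: ennreal_mult'[symmetric] powr_add[symmetric] mult.left_commute)
  also have "ennreal (K * U powr (k - b)) + ennreal (2 powr b * K * U powr (k - b) * (1 / (1 - q)))
     = ennreal (K * U powr (k - b) + 2 powr b * K * U powr (k - b) * (1 / (1 - q)))"
    using K q by (simp add: ennreal_plus)
  also have "K * U powr (k - b) + 2 powr b * K * U powr (k - b) * (1 / (1 - q))
     = (1 + 2 powr b / (1 - 2 powr (b - k))) * K * U powr (k - b)"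
    by (simp add: q_def algebra_simps)
  finally show ?thesis .
qed

text \<open>The same sum run upwards from \<open>T\<close>: now b exceeds k, the ratio is 2^(k-b) <
  1, and the growth bound alone controls every shell.\<close>

lemma nn_integral_negative_power_far:
  fixes \<psi> :: "'b \<Rightarrow> real"
  assumes \<psi>[measurable]: "\<psi> \<in> borel_measurable M"
    and b: "0 < k" "k < b" and K: "0 \<le> K" and T: "0 < T"
    and sub: "\<And>t. 0 < t \<Longrightarrow> emeasure M {y \<in> space M. \<psi> y < t} \<le> ennreal (K * t powr k)"
  shows "(\<integral>\<^sup>+y\<in>{y. T \<le> \<psi> y}. ennreal (\<psi> y powr (- b)) \<partial>M)
    \<le> ennreal (2 powr k / (1 - 2 powr (k - b)) * K * T powr (k - b))"
proof -
  define c where "c = (\<lambda>j::nat. (T * 2 ^ j) powr (- b))"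
  define q where "q = 2 powr (k - b)"
  have q: "0 < q" "q < 1" using b by (auto simp: q_def powr_less_one)
  have pw: "ennreal (\<psi> y powr (- b)) * indicator {y. T \<le> \<psi> y} y
      \<le> (\<Sum>j. ennreal (c j) * indicator {y \<in> space M. \<psi> y < T * 2 ^ Suc j} y)"
    if y: "y \<in> space M" for y
  proof (cases "T \<le> \<psi> y")
    case True
    then obtain j :: nat where j: "T * 2 ^ j \<le> \<psi> y" "\<psi> y < T * 2 ^ Suc j"
      using dyadic_scale_above T by blast
    have "ennreal (\<psi> y powr (- b)) * indicator {y. T \<le> \<psi> y} y \<le> ennreal (c j) * 1"
      unfolding c_def using j b T
      by (intro mult_mono ennreal_leI powr_mono2') (auto simp: indicator_def)
    also have "\<dots> = (\<Sum>i\<in>{j}. ennreal (c i) * indicator {y \<in> space M. \<psi> y < T * 2 ^ Suc i} y)"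
      using j y by simp
    also have "\<dots> \<le> (\<Sum>i. ennreal (c i) * indicator {y \<in> space M. \<psi> y < T * 2 ^ Suc i} y)"
      by (intro sum_le_suminf) auto
    finally show ?thesis .
  qed auto
  have summand: "c j * (K * (T * 2 ^ Suc j) powr k) = 2 powr k * K * T powr (k - b) * q ^ j" for j
  proof -
    have 1: "(T * 2 ^ Suc j) powr k = T powr k * (2 powr k * 2 powr (real j * k))"
      using T by (simp add: powr_mult powr_realpow[symmetric] powr_powr)
    have 2: "c j = T powr (- b) * 2 powr (- (real j * b))"
      using T by (simp add: c_def powr_mult powr_realpow[symmetric] powr_powr)
    have 3: "q ^ j = 2 powr (real j * k) * 2 powr (- (real j * b))"
      by (simp add: q_def powr_realpow[symmetric] powr_powr powr_add[symmetric] algebra_simps)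
    have 4: "T powr (k - b) = T powr k * T powr (- b)"
      by (simp add: powr_add[symmetric])
    show ?thesis unfolding 1 2 3 4 by (simp add: algebra_simps)
  qed
  have "(\<integral>\<^sup>+y\<in>{y. T \<le> \<psi> y}. ennreal (\<psi> y powr (- b)) \<partial>M) \<le>
      (\<integral>\<^sup>+y. (\<Sum>j. ennreal (c j) * indicator {y \<in> space M. \<psi> y < T * 2 ^ Suc j} y) \<partial>M)"
    by (intro nn_integral_mono pw)
  also have "\<dots> = (\<Sum>j. ennreal (c j) * emeasure M {y \<in> space M. \<psi> y < T * 2 ^ Suc j})"
    by (simp add: nn_integral_suminf nn_integral_cmult)
  also have "\<dots> \<le> (\<Sum>j. ennreal (c j) * ennreal (K * (T * 2 ^ Suc j) powr k))"
    using T by (intro mult_left_mono suminf_le sub) auto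
  also have "\<dots> = (\<Sum>j. ennreal (2 powr k * K * T powr (k - b) * q ^ j))"
    by (intro suminf_cong) (simp only: summand ennreal_mult''[symmetric] K powr_ge_zero mult_nonneg_nonneg)
  also have "\<dots> = ennreal (2 powr k * K * T powr (k - b) * (1 / (1 - q)))"
  proof -
    have "(\<lambda>j. 2 powr k * K * T powr (k - b) * q ^ j) sums (2 powr k * K * T powr (k - b) * (1 / (1 - q)))"
      by (intro sums_mult geometric_sums) (use q in auto)
    then show ?thesis using K q by (intro suminf_ennreal_eq) auto
  qed
  also have "2 powr k * K * T powr (k - b) * (1 / (1 - q))
     = 2 powr k / (1 - 2 powr (k - b)) * K * T powr (k - b)"
    by (simp add: q_def algebra_simps)
  finally show ?thesis .
qed

section \<open>Cubes and the pointwise A1 condition\<close>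

text \<open>Centre and radius make cubes the closed balls of \<open>infnorm\<close>, so inclusions
  become triangle inequalities. The side is 2r, the source of the factors (2r)^n below.\<close>

definition ccube :: "'a::euclidean_space \<Rightarrow> real \<Rightarrow> 'a set" where
  "ccube x r = cbox (x - r *\<^sub>R One) (x + r *\<^sub>R One)"

lemma mem_ccube: "y \<in> ccube x r \<longleftrightarrow> infnorm (x - y) \<le> r"
  by (auto simp: ccube_def mem_box infnorm_Max inner_diff_left inner_add_left abs_le_iff algebra_simps)

lemma ccube_mono: "infnorm (x - z) + r \<le> R \<Longrightarrow> ccube x r \<subseteq> ccube z R"
proof
  fix y assume "infnorm (x - z) + r \<le> R" "y \<in> ccube x r"
  then show "y \<in> ccube z R"
    using infnorm_triangle[of "z - x" "x - y"] infnorm_sub[of z x] by (simp add: mem_ccube)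
qed

lemma ccube_mono_radius: "r \<le> R \<Longrightarrow> ccube x r \<subseteq> ccube x R"
  by (auto simp: mem_ccube)

lemma ccube_borel [measurable, simp]: "ccube x r \<in> sets borel"
  by (simp add: ccube_def)

lemma ccube_lebesgue [measurable, simp]: "ccube x r \<in> sets lebesgue"
  by (simp add: ccube_def)

lemma diff_plus_double_scaleR:
  "x - r *\<^sub>R e + (2 * r) *\<^sub>R e = x + r *\<^sub>R (e :: 'a::real_vector)"
  unfolding mult_2 scaleR_left_distrib by (simp only: add.assoc[symmetric] diff_add_cancel)

lemma cube_ccube:
  assumes "0 < r" shows "cube (ccube x r)"
proof -
  have "ccube x r = cbox (x - r *\<^sub>R One) ((x - r *\<^sub>R One) + (2 * r) *\<^sub>R One)"
    unfolding ccube_def diff_plus_double_scaleR ..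
  moreover have "0 < 2 * r" using assms by simp
  ultimately show ?thesis unfolding cube_def by blast
qed

lemma cube_obtain_ccube:
  assumes "cube Q" obtains x r where "0 < r" "Q = ccube x r"
proof -
  obtain z h where z: "h > 0" "Q = cbox z (z + h *\<^sub>R One)"
    using assms by (auto simp: cube_def)
  have "Q = ccube (z + (h/2) *\<^sub>R One) (h/2)"
    using diff_plus_double_scaleR[of "z + (h/2) *\<^sub>R One" "h/2" One] z by (simp add: ccube_def add.assoc)
  then show ?thesis using that[of "h/2"] z by simp
qed

lemma content_ccube:
  fixes x :: "'a::euclidean_space"
  assumes "0 \<le> r"
  shows "measure lborel (ccube x r) = (2 * r) ^ DIM('a)"
  using content_cbox_plus[of "x - r *\<^sub>R One" "2 * r"] assms
  unfolding ccube_def diff_plus_double_scaleR by simp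

lemma emeasure_ccube:
  fixes x :: "'a::euclidean_space"
  assumes "0 \<le> r"
  shows "emeasure lborel (ccube x r) = ennreal ((2 * r) ^ DIM('a))"
proof -
  have "emeasure lborel (ccube x r) < \<infinity>"
    unfolding ccube_def by (rule emeasure_lborel_cbox_finite)
  then show ?thesis
    using content_ccube[OF assms, of x] by (subst emeasure_eq_ennreal_measure) auto
qed

lemma measure_lebesgue_ccube:
  fixes x :: "'a::euclidean_space"
  assumes "0 \<le> r"
  shows "measure lebesgue (ccube x r) = (2 * r) ^ DIM('a)"
  using content_ccube[OF assms, of x] by simp

lemma borel_measurable_infnorm [measurable]:
  "(infnorm :: 'a::euclidean_space \<Rightarrow> real) \<in> borel_measurable borel"
  by (intro borel_measurable_continuous_onI continuous_intros continuous_on_id)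

text \<open>Serves to turn a union of nested cubes over uncountably many radii into an increasing
  countable one. \<open>R\<close> is an interval beginning at 0: a largest element gives a constant
  sequence; otherwise the rationals in \<open>R\<close> are cofinal, and running maxima of an
  enumeration make them increase.\<close>

lemma cofinal_sequence:
  fixes R :: "real set"
  assumes ne: "R \<noteq> {}" and down: "\<And>r r'. r \<in> R \<Longrightarrow> 0 < r' \<Longrightarrow> r' \<le> r \<Longrightarrow> r' \<in> R"
    and pos: "\<And>r. r \<in> R \<Longrightarrow> 0 < r"
  shows "\<exists>f::nat \<Rightarrow> real. incseq f \<and> range f \<subseteq> R \<and> (\<forall>r\<in>R. \<exists>m. r \<le> f m)"
proof -
  obtain Q where Q: "countable Q" "Q \<subseteq> R" "\<And>r. r \<in> R \<Longrightarrow> \<exists>q\<in>Q. r \<le> q"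
  proof (cases "\<exists>m\<in>R. \<forall>r\<in>R. r \<le> m")
    case True
    then obtain m where "m \<in> R" "\<forall>r\<in>R. r \<le> m" by auto
    then show ?thesis by (intro that[of "{m}"]) auto
  next
    case False
    show ?thesis
    proof (rule that[of "R \<inter> \<rat>"])
      fix r assume r: "r \<in> R"
      then obtain r' where r': "r' \<in> R" "r < r'" using False by force
      obtain q where "q \<in> \<rat>" "r < q" "q < r'" using Rats_dense_in_real[OF r'(2)] by auto
      then show "\<exists>q\<in>R \<inter> \<rat>. r \<le> q"
        using down[OF r'(1), of q] pos[OF r] by (intro bexI[of _ q]) auto
    qed (auto simp: countable_rat intro: countable_Int2)
  qed
  have Qne: "Q \<noteq> {}" using Q(3) ne by auto
  define f where "f = (\<lambda>m. Max (from_nat_into Q ` {..m::nat}))"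
  have "f m \<in> R" for m
  proof -
    have "f m \<in> from_nat_into Q ` {..m}"
      unfolding f_def by (intro Max_in) auto
    then obtain i where "f m = from_nat_into Q i" by (rule imageE)
    then show ?thesis using Q(2) from_nat_into[OF Qne, of i] by auto
  qed
  moreover have "incseq f"
    unfolding f_def by (intro monoI Max_mono) auto
  moreover have "\<exists>m. r \<le> f m" if r: "r \<in> R" for r
  proof -
    obtain q where q: "q \<in> Q" "r \<le> q" using Q(3)[OF r] by auto
    obtain m where "from_nat_into Q m = q" using from_nat_into_surj[OF Q(1) q(1)] by auto
    then have "q \<le> f m" unfolding f_def by (intro Max_ge) auto
    then show ?thesis using q by (intro exI[of _ m]) auto
  qed
  ultimately show ?thesis by (intro exI[of _ f] conjI ballI subsetI) auto
qed

text \<open>The set of \<open>y\<close> for which the cube centred at \<open>x\<close> and reaching \<open>y\<close> has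
  small \<open>m\<close>-mass is an increasing union of such cubes, so no doubling is needed.\<close>

lemma emeasure_ccube_sublevel:
  fixes x :: "'a::euclidean_space" and m :: "real \<Rightarrow> real"
  assumes sets: "sets \<nu> = sets borel"
    and le: "\<And>r. 0 < r \<Longrightarrow> emeasure \<nu> (ccube x r) \<le> ennreal (K * m r powr k)"
    and m: "\<And>r. 0 \<le> m r" "\<And>r r'. 0 < r \<Longrightarrow> r \<le> r' \<Longrightarrow> m r \<le> m r'"
    and k: "0 < k" and K: "0 \<le> K" and S: "S \<in> sets borel"
    and AE: "AE y in \<nu>. y \<in> S \<longrightarrow> y \<noteq> x \<and> m (infnorm (x - y)) < t"
  shows "emeasure \<nu> S \<le> ennreal (K * t powr k)"
proof -
  \<comment> \<open>As \<open>m\<close> is only monotone, the supremum of \<open>R\<close> may or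
    may not be attained and may be infinite; a cofinal sequence inside \<open>R\<close> treats these
    cases alike.\<close>
  define R where "R = {r. 0 < r \<and> m r < t}"
  have AE': "AE y in \<nu>. y \<in> S \<longrightarrow> infnorm (x - y) \<in> R"
    using AE by eventually_elim (auto simp: R_def infnorm_pos_lt)
  show ?thesis
  proof (cases "R = {}")
    case True
    then have "AE y in \<nu>. y \<notin> S" using AE' by auto
    then have "emeasure \<nu> S = 0"
      using sets S by (subst (asm) AE_iff_measurable[of S]) (auto simp: sets_eq_imp_space_eq[OF sets])
    then show ?thesis by simp
  next
    case False
    obtain f :: "nat \<Rightarrow> real" where f: "incseq f" "range f \<subseteq> R" "\<And>r. r \<in> R \<Longrightarrow> \<exists>j. r \<le> f j"
    proof -
      have "r' \<in> R" if "r \<in> R" "0 < r'" "r' \<le> r" for r r'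
        using that m(2)[of r' r] by (auto simp: R_def)
      then have "\<exists>f::nat \<Rightarrow> real. incseq f \<and> range f \<subseteq> R \<and> (\<forall>r\<in>R. \<exists>m. r \<le> f m)"
        using False by (intro cofinal_sequence) (auto simp: R_def)
      then show ?thesis using that by blast
    qed
    have fR: "0 < f j" "m (f j) < t" for j using f(2) by (auto simp: R_def)
    have "emeasure \<nu> S \<le> emeasure \<nu> (\<Union>j. ccube x (f j))"
    proof (rule emeasure_mono_AE)
      show "AE y in \<nu>. y \<in> S \<longrightarrow> y \<in> (\<Union>j. ccube x (f j))"
        using AE' by eventually_elim (auto simp: mem_ccube dest: f(3))
    qed (simp add: sets)
    also have "\<dots> = (SUP j. emeasure \<nu> (ccube x (f j)))"
      using f(1) by (intro SUP_emeasure_incseq[symmetric])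
        (auto simp: sets incseq_def intro!: ccube_mono_radius)
    also have "\<dots> \<le> ennreal (K * t powr k)"
    proof (rule SUP_least)
      fix j
      have "m (f j) powr k \<le> t powr k"
        using fR[of j] k m(1) by (intro powr_mono2) auto
      then show "emeasure \<nu> (ccube x (f j)) \<le> ennreal (K * t powr k)"
        using fR[of j] K by (intro order_trans[OF le] ennreal_leI mult_left_mono) auto
    qed
    finally show ?thesis .
  qed
qed

text \<open>The essential infimum is a supremum of almost everywhere lower bounds. Countably many of
  them approach it, and their exceptional sets have a null union.\<close>

lemma A1_AE_avg_le:
  fixes u :: "'a::euclidean_space \<Rightarrow> real"
  assumes w: "weight u" and C: "avg u Q \<le> C * ess_inf_on Q u" and Q: "cube Q" and "0 \<le> C"
  shows "AE x in lebesgue. x \<in> Q \<longrightarrow> avg u Q \<le> C * u x"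
proof -
  define T where "T = {t. AE x in lebesgue. x \<in> Q \<longrightarrow> t \<le> u x}"
  have "0 \<in> T"
    using w by (auto simp: T_def weight_def elim: eventually_mono)
  obtain t where t: "\<And>j::nat. t j \<in> T" "\<And>j. Sup T - 1 / Suc j < t j"
  proof -
    have "\<exists>t\<in>T. Sup T - 1 / Suc j < t" for j :: nat
    proof (rule ccontr)
      assume "\<not> (\<exists>t\<in>T. Sup T - 1 / Suc j < t)"
      then have "Sup T \<le> Sup T - 1 / Suc j"
        using \<open>0 \<in> T\<close> by (intro cSup_least) auto
      then show False by simp
    qed
    then have "\<forall>j::nat. \<exists>t. t \<in> T \<and> Sup T - 1 / Suc j < t" by blast
    then obtain t where "\<forall>j::nat. t j \<in> T \<and> Sup T - 1 / Suc j < t j" by (auto dest!: choice)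
    then show ?thesis using that by blast
  qed
  have "AE x in lebesgue. \<forall>j. x \<in> Q \<longrightarrow> t j \<le> u x"
    using t(1) unfolding AE_all_countable by (simp add: T_def)
  then show ?thesis
  proof eventually_elim
    case (elim x)
    show ?case
    proof
      assume "x \<in> Q"
      have "Sup T \<le> u x + e" if "0 < e" for e
      proof -
        obtain j where "1 / Suc j < e" using nat_approx_posE[OF \<open>0 < e\<close>] by blast
        then show ?thesis using t(2)[of j] elim[rule_format, OF \<open>x \<in> Q\<close>, of j] by linarith
      qed
      then have "Sup T \<le> u x" by (rule field_le_epsilon)
      then show "avg u Q \<le> C * u x"
        using C \<open>0 \<le> C\<close> mult_left_mono[of "Sup T" "u x" C] by (simp add: ess_inf_on_def T_def)
    qed
  qed
qed

text \<open>Integrating a lower bound over \<open>Q\<close> shows that it cannot exceed the average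
  of \<open>u\<close>, so the real \<open>Sup\<close> is taken over a bounded set, and that set
  contains 0. The sign lets the A1 constant be enlarged to a positive one.\<close>

lemma ess_inf_on_nonneg:
  fixes u :: "'a::euclidean_space \<Rightarrow> real"
  assumes w: "weight u" and Q: "cube Q"
  shows "0 \<le> ess_inf_on Q u"
proof -
  define T where "T = {t. AE x in lebesgue. x \<in> Q \<longrightarrow> t \<le> u x}"
  obtain x r where xr: "0 < r" "Q = ccube x r" using Q by (rule cube_obtain_ccube)
  have int: "set_integrable lebesgue Q u" using w Q by (auto simp: weight_def loc_int_def)
  have "t \<le> avg u Q" if "t \<in> T" for t
  proof -
    have "(LINT x:Q|lebesgue. t) \<le> wmeas u Q"
      unfolding wmeas_def set_lebesgue_integral_def
    proof (rule integral_mono_AE)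
      show "integrable lebesgue (\<lambda>x. indicator Q x *\<^sub>R t)"
        using xr emeasure_lborel_cbox_finite
        by (intro integrable_scaleR_left integrable_real_indicator) (auto simp: ccube_def)
      show "AE x in lebesgue. indicator Q x *\<^sub>R t \<le> indicator Q x *\<^sub>R u x"
        using that unfolding T_def by (auto elim!: eventually_mono simp: indicator_def)
    qed (use int in \<open>simp add: set_integrable_def\<close>)
    moreover have "(LINT x:Q|lebesgue. t) = (2 * r) ^ DIM('a) * t"
      using xr by (simp add: set_lebesgue_integral_def content_ccube)
    ultimately show ?thesis
      using xr by (simp add: avg_def content_ccube field_simps)
  qed
  then have "bdd_above T" by (auto simp: bdd_above_def)
  moreover have "0 \<in> T"
    using w by (auto simp: T_def weight_def elim: eventually_mono)
  ultimately show ?thesis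
    unfolding ess_inf_on_def T_def[symmetric] by (intro cSup_upper)
qed

lemma wmeas_mono:
  assumes "weight u" "cube Q" "cube Q'" "Q \<subseteq> Q'"
  shows "wmeas u Q \<le> wmeas u Q'"
  unfolding wmeas_def set_lebesgue_integral_def
proof (rule integral_mono_AE)
  have "AE x in lebesgue. 0 < u x" using assms by (simp add: weight_def)
  then show "AE x in lebesgue. indicator Q x *\<^sub>R u x \<le> indicator Q' x *\<^sub>R u x"
    by eventually_elim (use assms(4) in \<open>auto simp: indicator_def\<close>)
qed (use assms in \<open>auto simp: weight_def loc_int_def set_integrable_def\<close>)

text \<open>One exceptional set must serve all cubes at once. It is built from the countably many
  cubes with centres in a dense set and rational radii; any cube lies in one of these of less than
  three times its radius, at the price of a factor 6^n.\<close>

lemma A1_pointwise: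
  fixes u :: "'a::euclidean_space \<Rightarrow> real"
  assumes "A1 u"
  shows "\<exists>C>0. AE y in lebesgue. \<forall>x r. 0 < r \<longrightarrow> infnorm (x - y) \<le> r \<longrightarrow>
    wmeas u (ccube x r) \<le> C * r ^ DIM('a) * u y"
proof -
  obtain C0 where w: "weight u" and C0: "\<And>Q. cube Q \<Longrightarrow> avg u Q \<le> C0 * ess_inf_on Q u"
    using assms by (auto simp: A1_def)
  define C where "C = max C0 1"
  have C: "avg u Q \<le> C * ess_inf_on Q u" if "cube Q" for Q
    using ess_inf_on_nonneg[OF w that]
    by (intro order_trans[OF C0[OF that] mult_right_mono]) (auto simp: C_def)
  obtain D :: "'a set" where D: "countable D" "\<And>X. open X \<Longrightarrow> X \<noteq> {} \<Longrightarrow> \<exists>d\<in>D. d \<in> X"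
    using countable_dense_setE by blast
  have "AE y in lebesgue. \<forall>q\<in>D. \<forall>r\<in>\<rat>. 0 < r \<longrightarrow> y \<in> ccube q r \<longrightarrow>
      avg u (ccube q r) \<le> C * u y"
  proof (intro AE_ball_countable'[OF _ D(1)] AE_ball_countable'[OF _ countable_rat] AE_impI)
    fix q :: 'a and r :: real assume "0 < r"
    then have "cube (ccube q r)" by (rule cube_ccube)
    then show "AE y in lebesgue. y \<in> ccube q r \<longrightarrow> avg u (ccube q r) \<le> C * u y"
      by (intro A1_AE_avg_le w C) (auto simp: C_def)
  qed
  moreover have "AE y in lebesgue. 0 < u y" using w by (simp add: weight_def)
  ultimately have "AE y in lebesgue. \<forall>x r. 0 < r \<longrightarrow> infnorm (x - y) \<le> r \<longrightarrow>
    wmeas u (ccube x r) \<le> (C * 6 ^ DIM('a)) * r ^ DIM('a) * u y"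
  proof eventually_elim
    case (elim y)
    show ?case
    proof (intro allI impI)
      fix x and r :: real assume r: "0 < r" "infnorm (x - y) \<le> r"
      obtain q where q: "q \<in> D" "q \<in> ball x r" using D(2)[of "ball x r"] r by auto
      \<comment> \<open>The centre moves by at most r, so radius 2r already covers the cube; the
        bound 3r becomes (6r)^n on passing to side lengths.\<close>
      obtain r' where r': "r' \<in> \<rat>" "2 * r < r'" "r' < 3 * r"
        using Rats_dense_in_real[of "2 * r" "3 * r"] r by auto
      have xq: "infnorm (x - q) \<le> r"
        using q infnorm_le_norm[of "x - q"] by (simp add: dist_norm)
      have sub: "ccube x r \<subseteq> ccube q r'" using xq r' by (intro ccube_mono) auto
      then have "y \<in> ccube q r'" using r by (auto simp: mem_ccube)
      then have a: "avg u (ccube q r') \<le> C * u y" using elim q r' r by auto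
      have "wmeas u (ccube x r) \<le> wmeas u (ccube q r')"
        using r r' sub by (intro wmeas_mono w cube_ccube) auto
      also have "\<dots> \<le> C * u y * (2 * r') ^ DIM('a)"
        using a r r' by (simp add: avg_def content_ccube field_simps)
      also have "\<dots> \<le> C * u y * (6 * r) ^ DIM('a)"
        using r r' elim by (intro mult_left_mono power_mono) (auto simp: C_def)
      finally show "wmeas u (ccube x r) \<le> (C * 6 ^ DIM('a)) * r ^ DIM('a) * u y"
        by (simp add: power_mult_distrib mult_ac)
    qed
  qed
  then show ?thesis by (intro exI[of _ "C * 6 ^ DIM('a)"]) (auto simp: C_def)
qed

section \<open>The Riesz potential on weighted Morrey spaces\<close>

text \<open>The weight is a Borel function that is positive everywhere, which makes Tonelli and
  division by \<open>u\<close> available. \<open>A1_AE\<close> is the A1 condition with one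
  exceptional set for all cubes; \<gamma> will be \<alpha> + \<beta>.\<close>

locale A1_morrey =
  fixes u :: "'a::euclidean_space \<Rightarrow> real" and C1 p s \<kappa> \<gamma> :: real
  assumes u_meas [measurable]: "u \<in> borel_measurable borel"
    and u_pos: "\<And>x. 0 < u x"
    and u_fin: "\<And>x r. emeasure (density lborel (\<lambda>x. ennreal (u x))) (ccube x r) < \<infinity>"
    and C1_pos: "0 < C1"
    and A1_AE: "AE y in lborel. \<forall>x r. 0 < r \<longrightarrow> infnorm (x - y) \<le> r \<longrightarrow>
      measure (density lborel (\<lambda>x. ennreal (u x))) (ccube x r) \<le> C1 * r ^ DIM('a) * u y"
    and gam: "0 < \<gamma>" "\<gamma> < real DIM('a)"
    and p: "1 < p" and s_pos: "0 < s" and s_eq: "1 / s = 1 / p - \<gamma> / real DIM('a)"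
    and kap: "0 < \<kappa>" "\<kappa> < p / s"
begin

definition \<mu> :: "'a measure" where "\<mu> = density lborel (\<lambda>x. ennreal (u x))"

definition \<psi> :: "'a \<Rightarrow> 'a \<Rightarrow> real" where "\<psi> x y = infnorm (x - y) ^ DIM('a) * u y"

text \<open>The kernel exponent \<gamma> - n, expressed in powers of |x-y|^n and with its sign
  reversed. The relation between p and s turns it into 1/s + (1 - 1/p), the total that every Hoelder
  splitting below has to match.\<close>

definition \<theta> :: real where "\<theta> = 1 - \<gamma> / real DIM('a)"

lemma sets_\<mu> [measurable_cong, simp]: "sets \<mu> = sets borel"
  by (simp add: \<mu>_def)

lemma space_\<mu> [simp]: "space \<mu> = UNIV"
  by (simp add: \<mu>_def)

lemma u_nonneg [simp]: "0 \<le> u x"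
  using u_pos[of x] by simp

lemma \<psi>_nonneg [simp]: "0 \<le> \<psi> x y"
  by (simp add: \<psi>_def infnorm_pos_le)

lemma \<psi>_meas [measurable]:
  assumes [measurable]: "f \<in> borel_measurable M" "g \<in> borel_measurable M"
  shows "(\<lambda>x. \<psi> (f x) (g x)) \<in> borel_measurable M"
  unfolding \<psi>_def by measurable

lemma emeasure_\<mu>: "emeasure \<mu> (ccube x r) = ennreal (measure \<mu> (ccube x r))"
  using u_fin[of x r] by (subst emeasure_eq_ennreal_measure) (auto simp: \<mu>_def)

lemma measure_\<mu>_mono: "ccube x r \<subseteq> ccube z R \<Longrightarrow> measure \<mu> (ccube x r) \<le> measure \<mu> (ccube z R)"
  using u_fin[of z R] by (intro measure_mono_fmeasurable) (auto simp: fmeasurable_def \<mu>_def)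

text \<open>The point y lies in the cube about x as well as in the cube about y, so the A1 bound by
  u(y) covers both. The exceptional set is the same for all x; \<open>x \<noteq> y\<close> keeps the
  radius positive.\<close>

lemma A1_\<psi>: "AE y in lborel. \<forall>x. x \<noteq> y \<longrightarrow>
   measure \<mu> (ccube x (infnorm (x - y))) \<le> C1 * \<psi> x y \<and>
   measure \<mu> (ccube y (infnorm (x - y))) \<le> C1 * \<psi> x y"
  using A1_AE
proof eventually_elim
  case (elim y)
  show ?case
  proof (intro allI impI)
    fix x assume "x \<noteq> y"
    then have "0 < infnorm (x - y)" by (simp add: infnorm_pos_lt)
    then show "measure \<mu> (ccube x (infnorm (x - y))) \<le> C1 * \<psi> x y \<and>
       measure \<mu> (ccube y (infnorm (x - y))) \<le> C1 * \<psi> x y"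
      using elim[rule_format, of "infnorm (x - y)" x] elim[rule_format, of "infnorm (x - y)" y]
      by (auto simp: \<mu>_def \<psi>_def mult.assoc infnorm_0)
  qed
qed

lemma measure_\<mu>_pos:
  assumes "0 < r" shows "0 < measure \<mu> (ccube x r)"
proof -
  have "emeasure \<mu> (ccube x r) \<noteq> 0"
  proof
    assume "emeasure \<mu> (ccube x r) = 0"
    then have "AE y in lborel. ennreal (u y) * indicator (ccube x r) y = 0"
      by (simp add: \<mu>_def emeasure_density nn_integral_0_iff_AE)
    then have "AE y in lborel. y \<notin> ccube x r"
    proof eventually_elim
      case (elim y)
      then show ?case using u_pos[of y] by (auto simp: indicator_def ennreal_eq_0_iff)
    qed
    then have "emeasure lborel (ccube x r) = 0"
      by (subst (asm) AE_iff_measurable[of "ccube x r"]) auto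
    then show False using assms by (simp add: emeasure_ccube)
  qed
  then show ?thesis
    using emeasure_\<mu>[of x r] by (simp add: zero_less_measure_iff)
qed

text \<open>Almost every y in the small cube satisfies the A1 bound for the large one. Integrating
  that bound over the small cube replaces u(y) by the mass; (3R)^n against the volume (2R)^n leaves
  (3/2)^n.\<close>

lemma doubling:
  assumes R: "0 < R"
  shows "measure \<mu> (ccube z (3 * R)) \<le> C1 * (3 / 2) ^ DIM('a) * measure \<mu> (ccube z R)"
proof -
  define m where "m = measure \<mu> (ccube z (3 * R))"
  have "AE y in lborel. ennreal m * indicator (ccube z R) y
      \<le> ennreal (C1 * (3 * R) ^ DIM('a)) * (ennreal (u y) * indicator (ccube z R) y)"
    using A1_AE
  proof eventually_elim
    case (elim y)
    have "m \<le> C1 * (3 * R) ^ DIM('a) * u y" if "y \<in> ccube z R"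
      using elim[rule_format, of "3 * R" z] R that by (simp add: m_def \<mu>_def mem_ccube)
    then show ?case
      using C1_pos R by (auto simp: indicator_def ennreal_mult'[symmetric] intro!: ennreal_leI)
  qed
  then have "(\<integral>\<^sup>+y. ennreal m * indicator (ccube z R) y \<partial>lborel)
     \<le> (\<integral>\<^sup>+y. ennreal (C1 * (3 * R) ^ DIM('a)) * (ennreal (u y) * indicator (ccube z R) y) \<partial>lborel)"
    by (rule nn_integral_mono_AE)
  then have "ennreal m * ennreal ((2 * R) ^ DIM('a))
     \<le> ennreal (C1 * (3 * R) ^ DIM('a)) * emeasure \<mu> (ccube z R)"
    using R by (simp add: nn_integral_cmult emeasure_ccube \<mu>_def emeasure_density)
  then have "m * (2 * R) ^ DIM('a) \<le> C1 * (3 * R) ^ DIM('a) * measure \<mu> (ccube z R)"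
    using R C1_pos by (simp add: emeasure_\<mu> ennreal_mult'[symmetric] m_def)
  then show ?thesis
    using R by (simp add: m_def power_mult_distrib power_divide field_simps)
qed

text \<open>If \<psi>(x,y) < t then, for almost every y, the cube about x reaching y has \<mu>-mass
  below C1 t, so the nested-cube bound applies. The density \<open>g\<close> is general in order to
  cover \<mu> itself with k = 1 and the Morrey measure with k = \<kappa>.\<close>

lemma sublevel_second:
  assumes g [measurable]: "g \<in> borel_measurable borel"
    and le: "\<And>r. 0 < r \<Longrightarrow> emeasure (density lborel g) (ccube x r)
        \<le> ennreal (K * measure \<mu> (ccube x r) powr k)"
    and k: "0 < k" "0 \<le> K" and t: "0 < t"
  shows "emeasure (density lborel g) {y. \<psi> x y < t} \<le> ennreal (K * C1 powr k * t powr k)"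
proof -
  have "emeasure (density lborel g) {y. \<psi> x y < t} \<le> ennreal (K * (C1 * t) powr k)"
  proof (rule emeasure_ccube_sublevel[where x = x and m = "\<lambda>r. measure \<mu> (ccube x r)"])
    show "{y. \<psi> x y < t} \<in> sets borel" by measurable
    have "AE y in lborel. y \<in> {y. \<psi> x y < t} \<longrightarrow>
        y \<noteq> x \<and> measure \<mu> (ccube x (infnorm (x - y))) < C1 * t"
      using A1_\<psi> AE_lborel_singleton[of x]
    proof eventually_elim
      case (elim y)
      then have "measure \<mu> (ccube x (infnorm (x - y))) \<le> C1 * \<psi> x y" by auto
      then show ?case using elim C1_pos by (auto elim!: le_less_trans)
    qed
    then show "AE y in density lborel g. y \<in> {y. \<psi> x y < t} \<longrightarrow>
        y \<noteq> x \<and> measure \<mu> (ccube x (infnorm (x - y))) < C1 * t"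
      by (subst AE_density) (auto elim: eventually_mono)
  qed (use le k in \<open>auto intro!: measure_\<mu>_mono ccube_mono_radius\<close>)
  then show ?thesis
    using C1_pos t by (simp add: powr_mult mult.assoc)
qed

lemma sublevel_\<mu>:
  assumes "0 < t"
  shows "emeasure \<mu> {y. \<psi> x y < t} \<le> ennreal (C1 * t powr 1)"
  using sublevel_second[of "\<lambda>y. ennreal (u y)" x 1 1 t] assms C1_pos
  by (simp add: \<mu>_def[symmetric] emeasure_\<mu>)

text \<open>Here the cubes are centred at y, the fixed point at which \<open>u\<close> is evaluated;
  the A1 bound is known for almost every such y, and for these it holds at all levels t.\<close>

lemma sublevel_first:
  "AE y in lborel. \<forall>t>0. emeasure \<mu> {x. \<psi> x y < t} \<le> ennreal (C1 * t powr 1)"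
  using A1_\<psi>
proof eventually_elim
  case (elim y)
  show ?case
  proof (intro allI impI)
    fix t :: real assume t: "0 < t"
    have "emeasure \<mu> {x. \<psi> x y < t} \<le> ennreal (1 * (C1 * t) powr 1)"
    proof (rule emeasure_ccube_sublevel[where x = y and m = "\<lambda>r. measure \<mu> (ccube y r)"])
      show "{x. \<psi> x y < t} \<in> sets borel" by measurable
      have "AE x in lborel. x \<in> {x. \<psi> x y < t} \<longrightarrow>
          x \<noteq> y \<and> measure \<mu> (ccube y (infnorm (y - x))) < C1 * t"
        using AE_lborel_singleton[of y]
      proof eventually_elim
        case x: (elim x)
        then have "measure \<mu> (ccube y (infnorm (y - x))) \<le> C1 * \<psi> x y"
          using elim by (auto simp: infnorm_sub[of y x])
        then show ?case using x C1_pos by (auto elim!: le_less_trans)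
      qed
      then show "AE x in \<mu>. x \<in> {x. \<psi> x y < t} \<longrightarrow>
          x \<noteq> y \<and> measure \<mu> (ccube y (infnorm (y - x))) < C1 * t"
        unfolding \<mu>_def by (subst AE_density) (auto elim: eventually_mono)
    qed (use emeasure_\<mu> in \<open>auto intro!: measure_\<mu>_mono ccube_mono_radius\<close>)
    then show "emeasure \<mu> {x. \<psi> x y < t} \<le> ennreal (C1 * t powr 1)"
      using C1_pos t by simp
  qed
qed

text \<open>\<open>M\<close> is any strictly positive bound for the Morrey norm instead of the norm
  itself, which may vanish. With u = w^s the density F^p u^(p/s) is |f|^p w^p.\<close>

definition morrey_bound :: "('a \<Rightarrow> real) \<Rightarrow> real \<Rightarrow> bool" where
  "morrey_bound F M \<longleftrightarrow> F \<in> borel_measurable borel \<and> (\<forall>y. 0 \<le> F y) \<and> 0 < M \<and>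
    (\<forall>x r. 0 < r \<longrightarrow> emeasure (density lborel (\<lambda>y. ennreal (F y powr p * u y powr (p / s)))) (ccube x r)
        \<le> ennreal (M powr p * measure \<mu> (ccube x r) powr \<kappa>))"

section \<open>Exponent arithmetic and the change of density\<close>

lemma exponents: "s > 1" "0 < 1 / p - 1 / s" "0 < 1 - 1 / p" "\<theta> = 1 / s + (1 - 1 / p)" "0 < \<theta>"
  "p / s = 1 - p * \<gamma> / real DIM('a)" "1 / p - 1 / s = \<gamma> / real DIM('a)"
proof -
  have "0 < \<gamma> / real DIM('a)" using gam by simp
  then show 2: "0 < 1 / p - 1 / s" using s_eq by simp
  show "s > 1"
  proof -
    have "1 / s < 1 / p" using 2 by simp
    also have "\<dots> < 1" using p by simp
    finally show ?thesis using s_pos by simp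
  qed
  show "0 < 1 - 1 / p" using p by simp
  show "\<theta> = 1 / s + (1 - 1 / p)" using s_eq by (simp add: \<theta>_def)
  show "0 < \<theta>" using gam by (simp add: \<theta>_def)
  have "p * (1 / s) = p * (1 / p - \<gamma> / real DIM('a))" using s_eq by simp
  then show "p / s = 1 - p * \<gamma> / real DIM('a)"
    using p by (simp add: right_diff_distrib)
  show "1 / p - 1 / s = \<gamma> / real DIM('a)" using s_eq by simp
qed

text \<open>The substitution \<open>F = h u\<^bsup>\<gamma>/n\<^esup>\<close> turns the Riesz kernel into a kernel that
  only depends on \<open>\<psi>\<close>, integrated against \<open>\<mu>\<close>.\<close>

definition density_ratio :: "('a \<Rightarrow> real) \<Rightarrow> 'a \<Rightarrow> real" where
  "density_ratio F y = F y * u y powr (- (\<gamma> / real DIM('a)))"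

lemma density_ratio_nonneg: "0 \<le> F y \<Longrightarrow> 0 \<le> density_ratio F y"
  by (simp add: density_ratio_def)

lemma density_ratio_meas [measurable]:
  "F \<in> borel_measurable borel \<Longrightarrow> density_ratio F \<in> borel_measurable borel"
  unfolding density_ratio_def[abs_def] by (intro borel_measurable_times powr_real_measurable u_meas) auto

text \<open>The power of \<open>u\<close> is 1 - p\<gamma>/n, which equals p/s. So the p-th power of
  the ratio, integrated against \<mu>, is the Morrey measure.\<close>

lemma density_ratio_powr: "0 \<le> F y \<Longrightarrow> u y * density_ratio F y powr p = F y powr p * u y powr (p / s)"
proof -
  assume F: "0 \<le> F y"
  have "u y * density_ratio F y powr p = F y powr p * (u y powr 1 * u y powr (- (\<gamma> / real DIM('a)) * p))"
    using F u_pos[of y] by (simp add: density_ratio_def powr_mult powr_powr)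
  also have "u y powr 1 * u y powr (- (\<gamma> / real DIM('a)) * p) = u y powr (p / s)"
    unfolding powr_add[symmetric] exponents(6) by (simp add: mult.commute)
  finally show ?thesis .
qed

text \<open>The powers of \<open>u\<close> cancel: 1 - \<gamma>/n - \<theta> = 0. On the diagonal
  both sides are 0, because in HOL 0 to any power under \<open>powr\<close> is 0.\<close>

lemma kernel_eq:
  assumes F: "0 \<le> F y"
  shows "F y * infnorm (x - y) powr (\<gamma> - real DIM('a)) = u y * (density_ratio F y * \<psi> x y powr (- \<theta>))"
proof (cases "infnorm (x - y) = 0")
  case True
  then show ?thesis by (simp add: \<psi>_def)
next
  case False
  then have pos: "0 < infnorm (x - y)" using infnorm_pos_le[of "x - y"] by simp
  have 1: "\<psi> x y powr (- \<theta>) = infnorm (x - y) powr (- (real DIM('a) * \<theta>)) * u y powr (- \<theta>)"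
    using pos u_pos[of y] by (simp add: \<psi>_def powr_mult powr_realpow[symmetric] powr_powr)
  have 2: "- (real DIM('a) * \<theta>) = \<gamma> - real DIM('a)"
    by (simp add: \<theta>_def right_diff_distrib)
  have "u y powr 1 * (u y powr (- (\<gamma> / real DIM('a))) * u y powr (- \<theta>)) = u y powr 0"
    unfolding powr_add[symmetric] by (simp add: \<theta>_def)
  then have "u y * (u y powr (- (\<gamma> / real DIM('a))) * u y powr (- \<theta>)) = 1"
    using u_pos[of y] by simp
  moreover have "u y * (density_ratio F y * \<psi> x y powr (- \<theta>)) = F y * infnorm (x - y) powr (\<gamma> - real DIM('a)) *
     (u y * (u y powr (- (\<gamma> / real DIM('a))) * u y powr (- \<theta>)))"
    unfolding 1 2 density_ratio_def by (simp add: mult_ac)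
  ultimately show ?thesis by simp
qed

text \<open>For x in the cube and almost every y outside its threefold dilate, \<psi>(x,y) is at
  least \<mu>(Q)/C1, so only shells going upwards occur. Hoelder with p and p' asks for an exponent
  above \<kappa> against the Morrey measure and one above 1 against \<mu>.\<close>

lemma tail_bound:
  "\<exists>C>0. \<forall>F M z R x. morrey_bound F M \<longrightarrow> 0 < R \<longrightarrow> x \<in> ccube z R \<longrightarrow>
     (\<integral>\<^sup>+y\<in>- ccube z (3 * R). ennreal (F y * infnorm (x - y) powr (\<gamma> - real DIM('a))) \<partial>lborel)
       \<le> ennreal (C * M * measure \<mu> (ccube z R) powr (\<kappa> / p - 1 / s))"
proof -
  define q where "q = 1 - 1 / p"
  \<comment> \<open>\<open>gap\<close> is the excess of \<theta> over \<kappa>/p + 1 - 1/p, the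
    total at which both integrals would be borderline. Half of it goes to each factor.\<close>
  define gap where "gap = 1 / s - \<kappa> / p"
  define \<epsilon> where "\<epsilon> = gap / 2"
  define b1 where "b1 = \<kappa> + \<epsilon> * p"
  define b2 where "b2 = 1 + \<epsilon> / q"
  have q: "0 < q" "1 / p + q = 1" using exponents by (auto simp: q_def)
  have "\<kappa> / p < 1 / s"
    using kap(2) p s_pos by (simp add: field_simps)
  then have \<epsilon>: "0 < \<epsilon>" by (simp add: \<epsilon>_def gap_def)
  have b: "\<kappa> < b1" "1 < b2" using \<epsilon> p q by (auto simp: b1_def b2_def)
  have "b1 / p + b2 * q = \<kappa> / p + q + 2 * \<epsilon>"
    using p q by (simp add: b1_def b2_def add_divide_distrib distrib_right)
  moreover have "2 * \<epsilon> = 1 / s - \<kappa> / p"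
    unfolding gap_def[symmetric] by (simp add: \<epsilon>_def)
  ultimately have b_sum: "b1 / p + b2 * q = \<theta>"
    unfolding exponents(4) by (simp add: q_def)
  define c1 where "c1 = 2 powr \<kappa> / (1 - 2 powr (\<kappa> - b1))"
  define c2 where "c2 = 2 powr 1 / (1 - 2 powr (1 - b2))"
  have c: "0 < c1" "0 < c2" using b by (auto simp: c1_def c2_def powr_less_one)
  define C where "C = (c1 * C1 powr \<kappa>) powr (1 / p) * (c2 * C1) powr q * (1 / C1) powr (\<kappa> / p - 1 / s)"
  show ?thesis
  proof (intro exI[of _ C] conjI allI impI)
    show "0 < C" using c C1_pos by (simp add: C_def)
    fix F and M :: real and z :: 'a and R x
    assume F: "morrey_bound F M" and R: "0 < (R::real)" and x: "x \<in> ccube z R"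
    have [measurable]: "F \<in> borel_measurable borel" and F0: "\<And>y. 0 \<le> F y" and M: "0 < M"
      using F by (auto simp: morrey_bound_def)
    define U where "U = measure \<mu> (ccube z R)"
    have U: "0 < U" using measure_\<mu>_pos[OF R] by (simp add: U_def)
    define T where "T = U / C1"
    have T: "0 < T" using U C1_pos by (simp add: T_def)
    define \<nu> where "\<nu> = density lborel (\<lambda>y. ennreal (F y powr p * u y powr (p / s)))"
    define N where "N = density lborel (\<lambda>y. ennreal (u y) * indicator {y. T \<le> \<psi> x y} y)"
    have sub_\<nu>: "emeasure \<nu> {y. \<psi> x y < t} \<le> ennreal (M powr p * C1 powr \<kappa> * t powr \<kappa>)" if "0 < t" for t
      unfolding \<nu>_def
      by (rule sublevel_second) (use that F kap in \<open>auto simp: morrey_bound_def\<close>)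
    have A: "(\<integral>\<^sup>+y. ennreal (density_ratio F y powr p * \<psi> x y powr (- b1)) \<partial>N)
        \<le> ennreal (c1 * (M powr p * C1 powr \<kappa>) * T powr (\<kappa> - b1))"
    proof -
      have "(\<integral>\<^sup>+y. ennreal (density_ratio F y powr p * \<psi> x y powr (- b1)) \<partial>N)
          = (\<integral>\<^sup>+y\<in>{y. T \<le> \<psi> x y}. ennreal (\<psi> x y powr (- b1)) \<partial>\<nu>)"
        unfolding N_def \<nu>_def
        by (subst nn_integral_density, measurable, subst nn_integral_density, measurable,
            intro nn_integral_cong)
           (simp add: density_ratio_powr[of F, symmetric] F0 ennreal_mult mult_ac)
      also have "\<dots> \<le> ennreal (c1 * (M powr p * C1 powr \<kappa>) * T powr (\<kappa> - b1))"
        unfolding c1_def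
        by (rule nn_integral_negative_power_far)
           (use b kap T sub_\<nu> in \<open>auto simp: \<nu>_def\<close>)
      finally show ?thesis .
    qed
    have B: "(\<integral>\<^sup>+y. ennreal (\<psi> x y powr (- b2)) \<partial>N) \<le> ennreal (c2 * C1 * T powr (1 - b2))"
    proof -
      have "(\<integral>\<^sup>+y. ennreal (\<psi> x y powr (- b2)) \<partial>N)
          = (\<integral>\<^sup>+y\<in>{y. T \<le> \<psi> x y}. ennreal (\<psi> x y powr (- b2)) \<partial>\<mu>)"
        unfolding N_def \<mu>_def
        by (subst nn_integral_density, measurable, subst nn_integral_density, measurable,
            intro nn_integral_cong) (simp add: mult_ac)
      also have "\<dots> \<le> ennreal (c2 * C1 * T powr (1 - b2))"
        unfolding c2_def
        by (rule nn_integral_negative_power_far)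
           (use b T C1_pos sublevel_\<mu> in auto)
      finally show ?thesis .
    qed
    have "(\<integral>\<^sup>+y\<in>- ccube z (3 * R). ennreal (F y * infnorm (x - y) powr (\<gamma> - real DIM('a))) \<partial>lborel)
        \<le> (\<integral>\<^sup>+y. (ennreal (u y) * indicator {y. T \<le> \<psi> x y} y) *
            ennreal ((density_ratio F y powr p * \<psi> x y powr (- b1)) powr (1 / p) * (\<psi> x y powr (- b2)) powr q) \<partial>lborel)"
    proof (rule nn_integral_mono_AE)
      show "AE y in lborel. ennreal (F y * infnorm (x - y) powr (\<gamma> - real DIM('a))) *
          indicator (- ccube z (3 * R)) y
        \<le> (ennreal (u y) * indicator {y. T \<le> \<psi> x y} y) *
            ennreal ((density_ratio F y powr p * \<psi> x y powr (- b1)) powr (1 / p) * (\<psi> x y powr (- b2)) powr q)"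
        using A1_\<psi>
      proof eventually_elim
        case (elim y)
        show ?case
        proof (cases "y \<in> ccube z (3 * R)")
          case False
          then have far: "3 * R < infnorm (z - y)" by (simp add: mem_ccube)
          have zx: "infnorm (z - x) \<le> R" using x by (simp add: mem_ccube)
          \<comment> \<open>Since |x-y| > 2R while |z-x| is at most R, the cube about x reaching y
            contains the original cube; its mass is therefore at least \<open>U\<close>.\<close>
          have "infnorm (z - y) \<le> infnorm (z - x) + infnorm (x - y)"
            using infnorm_triangle[of "z - x" "x - y"] by simp
          then have "2 * R < infnorm (x - y)" using far zx by simp
          then have sub: "ccube z R \<subseteq> ccube x (infnorm (x - y))" and "x \<noteq> y"
            using zx R by (auto intro!: ccube_mono simp: infnorm_0)
          have "U \<le> measure \<mu> (ccube x (infnorm (x - y)))"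
            unfolding U_def by (rule measure_\<mu>_mono[OF sub])
          also have "\<dots> \<le> C1 * \<psi> x y" using elim \<open>x \<noteq> y\<close> by blast
          finally have T_le: "T \<le> \<psi> x y" using C1_pos by (simp add: T_def field_simps)
          have "(density_ratio F y powr p * \<psi> x y powr (- b1)) powr (1 / p) * (\<psi> x y powr (- b2)) powr q
              = density_ratio F y * (\<psi> x y powr (- b1 / p) * \<psi> x y powr (- b2 * q))"
            using p by (simp add: powr_mult powr_powr density_ratio_nonneg F0)
          also have "\<dots> = density_ratio F y * \<psi> x y powr (- \<theta>)"
            unfolding powr_add[symmetric] b_sum[symmetric] by simp
          finally show ?thesis
            using T_le kernel_eq[of F y x] False
            by (simp add: F0 ennreal_mult'[symmetric])
        qed simp
      qed
    qed
    also have "\<dots> = (\<integral>\<^sup>+y. ennreal ((density_ratio F y powr p * \<psi> x y powr (- b1)) powr (1 / p)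
        * (\<psi> x y powr (- b2)) powr q) \<partial>N)"
      unfolding N_def by (rule nn_integral_density[symmetric]; measurable)
    also have "\<dots> \<le> ennreal ((c1 * (M powr p * C1 powr \<kappa>) * T powr (\<kappa> - b1)) powr (1 / p)
        * (c2 * C1 * T powr (1 - b2)) powr q)"
      by (rule nn_integral_Holder[OF _ _ _ _ _ _ _ _ _ A B])
         (use q p c M C1_pos T in \<open>auto simp: N_def\<close>)
    also have "(c1 * (M powr p * C1 powr \<kappa>) * T powr (\<kappa> - b1)) powr (1 / p)
        * (c2 * C1 * T powr (1 - b2)) powr q
      = (c1 * C1 powr \<kappa>) powr (1 / p) * (c2 * C1) powr q * M *
          (T powr ((\<kappa> - b1) / p) * T powr ((1 - b2) * q))"
      using c M C1_pos T p by (simp add: powr_mult powr_powr)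
    also have "T powr ((\<kappa> - b1) / p) * T powr ((1 - b2) * q) = T powr (\<kappa> / p - 1 / s)"
    proof -
      \<comment> \<open>Only the sum \<open>b1 / p + b2 * q\<close> matters, so \<epsilon>
        disappears from the power of \<open>T\<close>.\<close>
      have "(\<kappa> - b1) / p + (1 - b2) * q = \<kappa> / p + q - \<theta>"
        unfolding b_sum[symmetric] by (simp add: diff_divide_distrib left_diff_distrib)
      then show ?thesis
        unfolding powr_add[symmetric] exponents(4) by (simp add: q_def)
    qed
    also have "T powr (\<kappa> / p - 1 / s) = (1 / C1) powr (\<kappa> / p - 1 / s) * U powr (\<kappa> / p - 1 / s)"
      using U C1_pos by (simp add: T_def powr_divide)
    also have "(c1 * C1 powr \<kappa>) powr (1 / p) * (c2 * C1) powr q * M *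
        ((1 / C1) powr (\<kappa> / p - 1 / s) * U powr (\<kappa> / p - 1 / s)) = C * M * U powr (\<kappa> / p - 1 / s)"
      by (simp add: C_def mult_ac)
    finally show "(\<integral>\<^sup>+y\<in>- ccube z (3 * R). ennreal (F y * infnorm (x - y) powr (\<gamma> - real DIM('a))) \<partial>lborel)
       \<le> ennreal (C * M * measure \<mu> (ccube z R) powr (\<kappa> / p - 1 / s))"
      by (simp add: U_def)
  qed
qed

text \<open>Split h \<psi>^(-\<theta>) into the powers 1/s, P and q of h^p \<psi>^(-a), h^p
  \<psi>^(-e) and \<psi>^(-a). The last two y-integrals are bounded uniformly in x; the first is
  kept in the majorant \<open>G\<close>, and Tonelli moves the x-integral onto \<psi>^(-a), as in a
  Schur test. Finite \<open>t\<close> below the potential are used so that its finiteness is not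
  presupposed.\<close>

lemma local_bound:
  "\<exists>C>0. \<forall>F M z R. morrey_bound F M \<longrightarrow> 0 < R \<longrightarrow>
     (\<exists>G\<in>borel_measurable borel.
        (\<integral>\<^sup>+x\<in>ccube z R. G x \<partial>\<mu>) \<le> ennreal (C * M powr s * measure \<mu> (ccube z R) powr (\<kappa> * s / p)) \<and>
        (\<forall>x t. 0 \<le> t \<longrightarrow> ennreal t \<le> (\<integral>\<^sup>+y\<in>ccube z (3 * R).
            ennreal (F y * infnorm (x - y) powr (\<gamma> - real DIM('a))) \<partial>lborel) \<longrightarrow>
          ennreal (t powr s) \<le> G x))"
proof -
  define P where "P = 1 / p - 1 / s"
  define q where "q = 1 - 1 / p"
  \<comment> \<open>\<open>e\<close> is positive but below \<kappa>, and \<open>a\<close> is then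
    forced by a/s + eP + aq = \<theta>; e > 0 is what pushes \<open>a\<close> below 1, and e <
    \<theta> together with P < 1 keeps \<open>a\<close> positive.\<close>
  define e where "e = min (\<kappa> / 2) (\<theta> / 2)"
  define a where "a = 1 - e * P / \<theta>"
  have "P < 1" unfolding P_def exponents(7) using gam by simp
  then have P: "0 < P" "P < 1" "0 < q" "1 / s + P + q = 1" "0 < \<theta>" "1 < s" "\<theta> = 1 / s + q"
    using exponents(1-5) unfolding P_def q_def by simp_all
  have e: "0 < e" "e < \<kappa>" "e < \<theta>" using kap(1) P(5) by (auto simp: e_def min_def)
  have "e * P < \<theta> * 1" using e P by (intro mult_strict_mono) auto
  then have a: "0 < a" "a < 1" using e P by (auto simp: a_def)
  have a_eq: "(1 - a) * \<theta> = e * P" using P by (simp add: a_def)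
  have sum_eq: "a / s + e * P + a * q = \<theta>"
  proof -
    have "a / s + a * q = a * \<theta>" using P(7) by (simp add: distrib_left)
    also have "\<dots> = \<theta> - e * P" using a_eq by (simp add: left_diff_distrib)
    finally show ?thesis by simp
  qed
  \<comment> \<open>One constant for three purposes: sublevel growth, the mass of the dilated cube
    by doubling, and the trivial bound of \<open>U\<close> by \<open>K1 * U\<close>.\<close>
  define K1 where "K1 = C1 + C1 * (3 / 2) ^ DIM('a) + 1"
  have K1: "C1 \<le> K1" "C1 * (3 / 2) ^ DIM('a) \<le> K1" "1 \<le> K1" "0 < K1"
    using C1_pos by (auto simp: K1_def add_pos_pos)
  define cA where "cA = 1 + 2 powr e / (1 - 2 powr (e - \<kappa>))"
  define cB where "cB = 1 + 2 powr a / (1 - 2 powr (a - 1))"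
  have c: "0 < cA" "0 < cB" using a e by (auto simp: cA_def cB_def powr_less_one add_pos_pos)
  define C where "C = (cA * K1 powr \<kappa>) powr (P * s) * (cB * K1) powr (q * s + 1) * K1 powr \<kappa>"
  show ?thesis
  proof (intro exI[of _ C] conjI allI impI)
    show "0 < C" using c K1 by (simp add: C_def)
    fix F and M :: real and z :: 'a and R
    assume F: "morrey_bound F M" and R: "0 < (R::real)"
    have [measurable]: "F \<in> borel_measurable borel" and F0: "\<And>y. 0 \<le> F y" and M: "0 < M"
      using F by (auto simp: morrey_bound_def)
    define U where "U = measure \<mu> (ccube z R)"
    have U: "0 < U" using measure_\<mu>_pos[OF R] by (simp add: U_def)
    have U3: "measure \<mu> (ccube z (3 * R)) \<le> K1 * U"
      unfolding U_def using K1(2)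
      by (intro order_trans[OF doubling[OF R]] mult_right_mono) simp_all
    define \<nu> where "\<nu> = density lborel (\<lambda>y. ennreal (F y powr p * u y powr (p / s)))"
    define N where "N = density lborel (\<lambda>y. ennreal (u y) * indicator (ccube z (3 * R)) y)"
    have \<nu>3: "emeasure \<nu> (ccube z (3 * R)) \<le> ennreal (M powr p * K1 powr \<kappa> * U powr \<kappa>)"
    proof -
      have "emeasure \<nu> (ccube z (3 * R)) \<le> ennreal (M powr p * measure \<mu> (ccube z (3 * R)) powr \<kappa>)"
        using F R by (simp add: \<nu>_def morrey_bound_def)
      also have "\<dots> \<le> ennreal (M powr p * (K1 * U) powr \<kappa>)"
        using U3 kap by (intro ennreal_leI mult_left_mono powr_mono2) auto
      finally show ?thesis using K1 U by (simp add: powr_mult mult.assoc)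
    qed
    have sub_\<nu>: "emeasure \<nu> {y. \<psi> x y < t} \<le> ennreal (M powr p * K1 powr \<kappa> * t powr \<kappa>)"
      if "0 < t" for t x
    proof -
      have "emeasure \<nu> {y. \<psi> x y < t} \<le> ennreal (M powr p * C1 powr \<kappa> * t powr \<kappa>)"
        unfolding \<nu>_def
        by (rule sublevel_second) (use that F kap in \<open>auto simp: morrey_bound_def\<close>)
      also have "\<dots> \<le> ennreal (M powr p * K1 powr \<kappa> * t powr \<kappa>)"
        using C1_pos K1 kap
        by (intro ennreal_leI mult_left_mono mult_right_mono powr_mono2) auto
      finally show ?thesis .
    qed
    define B where "B = cA * (M powr p * K1 powr \<kappa>) * U powr (\<kappa> - e)"
    define D where "D = cB * K1 * U powr (1 - a)"
    have BD: "0 < B" "0 < D" using c M K1 U by (auto simp: B_def D_def)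
    have Y_le: "(\<integral>\<^sup>+y. ennreal (density_ratio F y powr p * \<psi> x y powr (- e)) \<partial>N) \<le> ennreal B" for x
    proof -
      have "(\<integral>\<^sup>+y. ennreal (density_ratio F y powr p * \<psi> x y powr (- e)) \<partial>N)
          = (\<integral>\<^sup>+y\<in>ccube z (3 * R). ennreal (\<psi> x y powr (- e)) \<partial>\<nu>)"
        unfolding N_def \<nu>_def
        by (subst nn_integral_density, measurable, subst nn_integral_density, measurable,
            intro nn_integral_cong)
           (simp add: density_ratio_powr[of F, symmetric] F0 ennreal_mult mult_ac)
      also have "\<dots> \<le> ennreal B"
        unfolding B_def cA_def
        by (rule nn_integral_negative_power_near)
           (use e U sub_\<nu> \<nu>3 in \<open>auto simp: \<nu>_def\<close>)
      finally show ?thesis .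
    qed
    have Z_le: "(\<integral>\<^sup>+y. ennreal (\<psi> x y powr (- a)) \<partial>N) \<le> ennreal D" for x
    proof -
      have "(\<integral>\<^sup>+y. ennreal (\<psi> x y powr (- a)) \<partial>N)
          = (\<integral>\<^sup>+y\<in>ccube z (3 * R). ennreal (\<psi> x y powr (- a)) \<partial>\<mu>)"
        unfolding N_def \<mu>_def
        by (subst nn_integral_density, measurable, subst nn_integral_density, measurable,
            intro nn_integral_cong) (simp add: mult_ac)
      also have "\<dots> \<le> ennreal D"
        unfolding D_def cB_def
      proof (rule nn_integral_negative_power_near)
        fix t :: real assume t: "0 < t"
        show "emeasure \<mu> {y \<in> space \<mu>. \<psi> x y < t} \<le> ennreal (K1 * t powr 1)"
          using order_trans[OF sublevel_\<mu>[OF t, of x] ennreal_leI[of "C1 * t powr 1" "K1 * t powr 1"]] K1 t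
          by simp
      qed (use a U U3 K1 in \<open>auto simp: emeasure_\<mu> intro!: ennreal_leI\<close>)
      finally show ?thesis .
    qed
    \<comment> \<open>Now x is the variable of integration, so growth in the first variable is used
      and y is only generic; the resulting bound \<open>D\<close> is the same.\<close>
    have X_le: "AE y in lborel. (\<integral>\<^sup>+x. ennreal (u x) * indicator (ccube z R) x * ennreal (\<psi> x y powr (- a)) \<partial>lborel)
        \<le> ennreal D"
      using sublevel_first
    proof eventually_elim
      case (elim y)
      have "(\<integral>\<^sup>+x. ennreal (u x) * indicator (ccube z R) x * ennreal (\<psi> x y powr (- a)) \<partial>lborel)
          = (\<integral>\<^sup>+x\<in>ccube z R. ennreal (\<psi> x y powr (- a)) \<partial>\<mu>)"
        unfolding \<mu>_def
        by (subst nn_integral_density, measurable, intro nn_integral_cong) (simp add: mult_ac)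
      also have "\<dots> \<le> ennreal D"
        unfolding D_def cB_def
      proof (rule nn_integral_negative_power_near)
        fix t :: real assume t: "0 < t"
        show "emeasure \<mu> {x \<in> space \<mu>. \<psi> x y < t} \<le> ennreal (K1 * t powr 1)"
          using order_trans[OF elim[rule_format, OF t] ennreal_leI[of "C1 * t powr 1" "K1 * t powr 1"]] K1 t
          by simp
      qed (use a U K1 mult_right_mono[OF K1(3), of U] in \<open>auto simp: emeasure_\<mu> U_def[symmetric] intro!: ennreal_leI\<close>)
      finally show ?case .
    qed
    \<comment> \<open>\<open>k\<close> is the s-th power of the two Hoelder factors that are bounded
      uniformly in x.\<close>
    define k where "k = B powr (P * s) * D powr (q * s)"
    define X where "X = (\<lambda>x y. ennreal (F y powr p * u y powr (p / s)) * indicator (ccube z (3 * R)) y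
        * ennreal (\<psi> x y powr (- a)))"
    have X_meas [measurable]: "case_prod X \<in> borel_measurable (borel \<Otimes>\<^sub>M borel)"
      unfolding X_def by measurable
    define G where "G = (\<lambda>x. ennreal k * (\<integral>\<^sup>+y. X x y \<partial>lborel))"
    have G_meas [measurable]: "G \<in> borel_measurable borel"
      unfolding G_def by measurable
    have X_N: "(\<integral>\<^sup>+y. ennreal (density_ratio F y powr p * \<psi> x y powr (- a)) \<partial>N) = (\<integral>\<^sup>+y. X x y \<partial>lborel)" for x
      unfolding N_def X_def
      by (subst nn_integral_density, measurable, intro nn_integral_cong)
         (simp add: density_ratio_powr[of F, symmetric] F0 ennreal_mult mult_ac)
    show "\<exists>G\<in>borel_measurable borel.
        (\<integral>\<^sup>+x\<in>ccube z R. G x \<partial>\<mu>) \<le> ennreal (C * M powr s * measure \<mu> (ccube z R) powr (\<kappa> * s / p)) \<and>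
        (\<forall>x t. 0 \<le> t \<longrightarrow> ennreal t \<le> (\<integral>\<^sup>+y\<in>ccube z (3 * R).
            ennreal (F y * infnorm (x - y) powr (\<gamma> - real DIM('a))) \<partial>lborel) \<longrightarrow>
          ennreal (t powr s) \<le> G x)"
    proof (intro bexI[of _ G] conjI allI impI)
      show "G \<in> borel_measurable borel" by (rule G_meas)
      fix x :: 'a and t assume t: "0 \<le> (t::real)" and t_le: "ennreal t \<le> (\<integral>\<^sup>+y\<in>ccube z (3 * R).
            ennreal (F y * infnorm (x - y) powr (\<gamma> - real DIM('a))) \<partial>lborel)"
      have pw: "F y * infnorm (x - y) powr (\<gamma> - real DIM('a)) =
          u y * ((density_ratio F y powr p * \<psi> x y powr (- a)) powr (1 / s) * (density_ratio F y powr p * \<psi> x y powr (- e)) powr P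
            * (\<psi> x y powr (- a)) powr q)" for y
      proof -
        \<comment> \<open>The two factors containing h^p together give h back to the first
          power.\<close>
        have "p * (1 / s) + p * P = 1" using p by (simp add: P_def right_diff_distrib)
        then have h: "density_ratio F y powr (p * (1 / s)) * density_ratio F y powr (p * P) = density_ratio F y"
          unfolding powr_add[symmetric] by (simp add: density_ratio_nonneg F0)
        have "- a * (1 / s) + (- e) * P + (- a) * q = - \<theta>"
          unfolding sum_eq[symmetric] by simp
        then have ps: "\<psi> x y powr (- a * (1 / s)) * \<psi> x y powr ((- e) * P) * \<psi> x y powr ((- a) * q) = \<psi> x y powr (- \<theta>)"
          unfolding powr_add[symmetric] by simp
        have "(density_ratio F y powr p * \<psi> x y powr (- a)) powr (1 / s) * (density_ratio F y powr p * \<psi> x y powr (- e)) powr P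
            * (\<psi> x y powr (- a)) powr q
          = (density_ratio F y powr (p * (1 / s)) * density_ratio F y powr (p * P)) *
            (\<psi> x y powr (- a * (1 / s)) * \<psi> x y powr ((- e) * P) * \<psi> x y powr ((- a) * q))"
          by (simp add: powr_mult powr_powr density_ratio_nonneg F0 mult_ac)
        then show ?thesis
          using kernel_eq[of F y x] F0 unfolding h ps by simp
      qed
      have "(\<integral>\<^sup>+y\<in>ccube z (3 * R). ennreal (F y * infnorm (x - y) powr (\<gamma> - real DIM('a))) \<partial>lborel)
        = (\<integral>\<^sup>+y. ennreal ((density_ratio F y powr p * \<psi> x y powr (- a)) powr (1 / s)
            * (density_ratio F y powr p * \<psi> x y powr (- e)) powr P * (\<psi> x y powr (- a)) powr q) \<partial>N)"
        unfolding N_def pw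
        by (subst nn_integral_density, measurable, intro nn_integral_cong) (simp add: ennreal_mult' mult_ac)
      then have t_le': "ennreal t \<le> (\<integral>\<^sup>+y. ennreal ((density_ratio F y powr p * \<psi> x y powr (- a)) powr (1 / s)
            * (density_ratio F y powr p * \<psi> x y powr (- e)) powr P * (\<psi> x y powr (- a)) powr q) \<partial>N)"
        using t_le by simp
      have "ennreal (t powr s) \<le> ennreal (B powr (P * s) * D powr (q * s)) *
          (\<integral>\<^sup>+y. ennreal (density_ratio F y powr p * \<psi> x y powr (- a)) \<partial>N)"
        by (rule Holder3_powr[OF _ _ _ _ _ _ _ _ _ _ _ _ _ Y_le Z_le t_le'])
           (use P BD t in \<open>auto simp: N_def\<close>)
      then show "ennreal (t powr s) \<le> G x"
        by (simp add: G_def k_def X_N)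
    next
      have "(\<integral>\<^sup>+x\<in>ccube z R. G x \<partial>\<mu>) = (\<integral>\<^sup>+x. ennreal (u x) * (G x * indicator (ccube z R) x) \<partial>lborel)"
        unfolding \<mu>_def by (rule nn_integral_density) measurable
      also have "\<dots> = (\<integral>\<^sup>+x. ennreal k * (\<integral>\<^sup>+y. ennreal (u x) * indicator (ccube z R) x * X x y \<partial>lborel) \<partial>lborel)"
        unfolding G_def by (subst nn_integral_cmult) (auto simp: mult_ac)
      also have "\<dots> = ennreal k * (\<integral>\<^sup>+x. \<integral>\<^sup>+y. ennreal (u x) * indicator (ccube z R) x * X x y \<partial>lborel \<partial>lborel)"
        by (subst nn_integral_cmult) auto
      \<comment> \<open>After the exchange the x-integral falls only on \<psi>^(-a) and is at most
        \<open>D\<close>, which leaves the Morrey mass of the dilated cube.\<close>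
      also have "(\<integral>\<^sup>+x. \<integral>\<^sup>+y. ennreal (u x) * indicator (ccube z R) x * X x y \<partial>lborel \<partial>lborel)
          = (\<integral>\<^sup>+y. \<integral>\<^sup>+x. ennreal (u x) * indicator (ccube z R) x * X x y \<partial>lborel \<partial>lborel)"
        by (rule lborel_pair.Fubini'[symmetric]) measurable
      also have "\<dots> \<le> (\<integral>\<^sup>+y. ennreal D * (ennreal (F y powr p * u y powr (p / s)) * indicator (ccube z (3 * R)) y) \<partial>lborel)"
      proof (rule nn_integral_mono_AE)
        show "AE y in lborel. (\<integral>\<^sup>+x. ennreal (u x) * indicator (ccube z R) x * X x y \<partial>lborel)
          \<le> ennreal D * (ennreal (F y powr p * u y powr (p / s)) * indicator (ccube z (3 * R)) y)"
          using X_le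
        proof eventually_elim
          case (elim y)
          define v where "v = ennreal (F y powr p * u y powr (p / s)) * indicator (ccube z (3 * R)) y"
          have "(\<integral>\<^sup>+x. ennreal (u x) * indicator (ccube z R) x * X x y \<partial>lborel)
            = (\<integral>\<^sup>+x. v * (ennreal (u x) * indicator (ccube z R) x * ennreal (\<psi> x y powr (- a))) \<partial>lborel)"
            by (simp add: X_def v_def mult_ac)
          also have "\<dots> = v * (\<integral>\<^sup>+x. ennreal (u x) * indicator (ccube z R) x * ennreal (\<psi> x y powr (- a)) \<partial>lborel)"
            by (subst nn_integral_cmult) auto
          also have "\<dots> \<le> v * ennreal D" by (intro mult_left_mono elim) simp
          finally show ?case by (simp add: v_def mult.commute)
        qed
      qed
      also have "\<dots> = ennreal D * emeasure \<nu> (ccube z (3 * R))"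
        unfolding \<nu>_def by (subst nn_integral_cmult) (auto simp: emeasure_density)
      also have "\<dots> \<le> ennreal D * ennreal (M powr p * K1 powr \<kappa> * U powr \<kappa>)"
        by (intro mult_left_mono \<nu>3) simp
      finally have "(\<integral>\<^sup>+x\<in>ccube z R. G x \<partial>\<mu>) \<le> ennreal k * (ennreal D * ennreal (M powr p * K1 powr \<kappa> * U powr \<kappa>))"
        by (simp add: mult_left_mono)
      also have "\<dots> = ennreal (k * (D * (M powr p * K1 powr \<kappa> * U powr \<kappa>)))"
        using BD by (simp add: k_def ennreal_mult)
      also have "k * (D * (M powr p * K1 powr \<kappa> * U powr \<kappa>)) = C * M powr s * U powr (\<kappa> * s / p)"
      proof -
        have M_exp: "M powr (p * (P * s)) * M powr p = M powr s"
        proof -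
          have "p * (P * s) + p = s" using p P(6) by (simp add: P_def field_simps)
          then show ?thesis unfolding powr_add[symmetric] by simp
        qed
        \<comment> \<open>The auxiliary exponents cancel: (1-a)\<theta> = eP makes the terms in
          \<open>e\<close> drop out, and Ps + 1 = s/p.\<close>
        have U_exp: "U powr ((\<kappa> - e) * (P * s)) * (U powr ((1 - a) * (q * s + 1)) * U powr \<kappa>) = U powr (\<kappa> * s / p)"
        proof -
          have "q * s + 1 = \<theta> * s" unfolding P(7) using P(6) by (simp add: field_simps)
          then have "(1 - a) * (q * s + 1) = e * P * s" using a_eq by (simp add: mult.assoc[symmetric])
          then have "(\<kappa> - e) * (P * s) + ((1 - a) * (q * s + 1) + \<kappa>)
              = (\<kappa> - e) * (P * s) + (e * P * s + \<kappa>)" by simp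
          also have "\<dots> = \<kappa> * (P * s + 1)" by (simp add: algebra_simps)
          also have "P * s + 1 = s / p" using P(6) by (simp add: P_def field_simps)
          finally show ?thesis unfolding powr_add[symmetric] by simp
        qed
        have D_exp: "D powr (q * s) * D = (cB * K1) powr (q * s + 1) * U powr ((1 - a) * (q * s + 1))"
        proof -
          have "D powr (q * s) * D = D powr (q * s + 1)" using BD by (simp add: powr_add)
          also have "\<dots> = (cB * K1) powr (q * s + 1) * U powr ((1 - a) * (q * s + 1))"
            unfolding D_def using c K1 U by (subst powr_mult) (auto simp: powr_powr)
          finally show ?thesis .
        qed
        have B_exp: "B powr (P * s) = (cA * K1 powr \<kappa>) powr (P * s) * M powr (p * (P * s)) * U powr ((\<kappa> - e) * (P * s))"
          unfolding B_def using c K1 U M by (simp add: powr_mult powr_powr)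
        have "k * (D * (M powr p * K1 powr \<kappa> * U powr \<kappa>))
          = B powr (P * s) * (D powr (q * s) * D) * M powr p * K1 powr \<kappa> * U powr \<kappa>"
          by (simp add: k_def mult_ac)
        also have "\<dots> = C * (M powr (p * (P * s)) * M powr p) *
            (U powr ((\<kappa> - e) * (P * s)) * (U powr ((1 - a) * (q * s + 1)) * U powr \<kappa>))"
          unfolding B_exp D_exp C_def by (simp only: mult_ac)
        finally show ?thesis unfolding M_exp U_exp .
      qed
      finally show "(\<integral>\<^sup>+x\<in>ccube z R. G x \<partial>\<mu>)
          \<le> ennreal (C * M powr s * measure \<mu> (ccube z R) powr (\<kappa> * s / p))"
        by (simp add: U_def)
    qed
  qed
qed

text \<open>Either a value below the potential is at most twice the tail bound, or the local part
  carries at least half of it. \<open>H\<close> is an arbitrary function dominated by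
  \<open>L\<close> times the potential, so that the commutator, not itself a potential, can be
  inserted.\<close>

lemma riesz_potential_morrey_bound:
  "\<exists>C>0. \<forall>F M z R L H. morrey_bound F M \<longrightarrow> 0 < R \<longrightarrow> 0 \<le> L \<longrightarrow>
     (AE x in lborel. ennreal \<bar>H x\<bar> \<le> ennreal L *
        (\<integral>\<^sup>+y. ennreal (F y * infnorm (x - y) powr (\<gamma> - real DIM('a))) \<partial>lborel)) \<longrightarrow>
     (\<integral>\<^sup>+x\<in>ccube z R. ennreal (\<bar>H x\<bar> powr s * u x) \<partial>lborel)
       \<le> ennreal (C * L powr s * M powr s * measure \<mu> (ccube z R) powr (\<kappa> * s / p))"
proof -
  obtain C where C: "0 < C" "\<And>F M z R x. morrey_bound F M \<Longrightarrow> 0 < R \<Longrightarrow> x \<in> ccube z R \<Longrightarrow>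
     (\<integral>\<^sup>+y\<in>- ccube z (3 * R). ennreal (F y * infnorm (x - y) powr (\<gamma> - real DIM('a))) \<partial>lborel)
       \<le> ennreal (C * M * measure \<mu> (ccube z R) powr (\<kappa> / p - 1 / s))"
    using tail_bound by blast
  obtain C' where C': "0 < C'" "\<And>F M z R. morrey_bound F M \<Longrightarrow> 0 < R \<Longrightarrow>
     (\<exists>G\<in>borel_measurable borel.
        (\<integral>\<^sup>+x\<in>ccube z R. G x \<partial>\<mu>) \<le> ennreal (C' * M powr s * measure \<mu> (ccube z R) powr (\<kappa> * s / p)) \<and>
        (\<forall>x t. 0 \<le> t \<longrightarrow> ennreal t \<le> (\<integral>\<^sup>+y\<in>ccube z (3 * R).
            ennreal (F y * infnorm (x - y) powr (\<gamma> - real DIM('a))) \<partial>lborel) \<longrightarrow>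
          ennreal (t powr s) \<le> G x))"
    using local_bound by blast
  define K where "K = (2 * C) powr s + 2 powr s * C'"
  show ?thesis
  proof (intro exI[of _ K] conjI allI impI)
    show "0 < K" using C(1) C'(1) by (simp add: K_def add_pos_pos)
    fix F and M :: real and z :: 'a and R L :: real and H
    assume F: "morrey_bound F M" and R: "0 < R" and L: "0 \<le> L"
      and H: "AE x in lborel. ennreal \<bar>H x\<bar> \<le> ennreal L *
        (\<integral>\<^sup>+y. ennreal (F y * infnorm (x - y) powr (\<gamma> - real DIM('a))) \<partial>lborel)"
    have [measurable]: "F \<in> borel_measurable borel" and M: "0 < M"
      using F by (auto simp: morrey_bound_def)
    define U where "U = measure \<mu> (ccube z R)"
    have U: "0 < U" using measure_\<mu>_pos[OF R] by (simp add: U_def)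
    define T where "T = C * M * U powr (\<kappa> / p - 1 / s)"
    have T: "0 < T" using C M U by (simp add: T_def)
    obtain G where [measurable]: "G \<in> borel_measurable borel" and
      G: "(\<integral>\<^sup>+x\<in>ccube z R. G x \<partial>\<mu>) \<le> ennreal (C' * M powr s * U powr (\<kappa> * s / p))" and
      G_le: "\<And>x t. 0 \<le> t \<Longrightarrow> ennreal t \<le> (\<integral>\<^sup>+y\<in>ccube z (3 * R).
            ennreal (F y * infnorm (x - y) powr (\<gamma> - real DIM('a))) \<partial>lborel) \<Longrightarrow>
          ennreal (t powr s) \<le> G x"
      using C'(2)[OF F R, of z] unfolding U_def by blast
    have key: "ennreal (t powr s) \<le> ennreal ((2 * T) powr s) + ennreal (2 powr s) * G x"
      if x: "x \<in> ccube z R" and t: "0 \<le> t"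
        and t_le: "ennreal t \<le> (\<integral>\<^sup>+y. ennreal (F y * infnorm (x - y) powr (\<gamma> - real DIM('a))) \<partial>lborel)"
      for x t
    proof (cases "t \<le> 2 * T")
      case True
      then have "t powr s \<le> (2 * T) powr s" using t s_pos by (intro powr_mono2) auto
      then show ?thesis by (intro add_increasing2 ennreal_leI) auto
    next
      case False
      define I where "I A = (\<integral>\<^sup>+y\<in>A. ennreal (F y * infnorm (x - y) powr (\<gamma> - real DIM('a))) \<partial>lborel)" for A
      have "(\<integral>\<^sup>+y. ennreal (F y * infnorm (x - y) powr (\<gamma> - real DIM('a))) \<partial>lborel)
          = I (ccube z (3 * R)) + I (- ccube z (3 * R))"
        unfolding I_def by (subst nn_integral_add[symmetric]; (measurable)?)
          (auto intro!: nn_integral_cong simp: indicator_def)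
      also have "\<dots> \<le> I (ccube z (3 * R)) + ennreal T"
        unfolding I_def T_def U_def by (intro add_left_mono C(2) F R x)
      finally have *: "ennreal t \<le> I (ccube z (3 * R)) + ennreal T" using t_le by simp
      have "ennreal (t / 2) \<le> I (ccube z (3 * R))"
      proof (rule ccontr)
        assume "\<not> ?thesis"
        then have lt: "I (ccube z (3 * R)) < ennreal (t / 2)" by simp
        then obtain i where i: "I (ccube z (3 * R)) = ennreal i" "0 \<le> i"
          by (metis enn2real_nonneg ennreal_enn2real ennreal_less_top less_trans)
        then have "i < t / 2" using lt by (simp add: ennreal_less_iff)
        moreover have "t \<le> i + T"
          using * T i by (simp add: ennreal_plus[symmetric] del: ennreal_plus)
        ultimately show False using False by simp
      qed
      then have "ennreal ((t / 2) powr s) \<le> G x"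
        using t unfolding I_def by (intro G_le) auto
      then have "ennreal (2 powr s) * ennreal ((t / 2) powr s) \<le> ennreal (2 powr s) * G x"
        by (rule mult_left_mono) simp
      also have "ennreal (2 powr s) * ennreal ((t / 2) powr s) = ennreal (t powr s)"
        using t by (simp add: ennreal_mult[symmetric] powr_divide)
      finally show ?thesis by (intro add_increasing) auto
    qed
    have "AE x in lborel. ennreal (\<bar>H x\<bar> powr s * u x) * indicator (ccube z R) x
      \<le> ennreal (L powr s) * (ennreal ((2 * T) powr s) * (ennreal (u x) * indicator (ccube z R) x)
           + ennreal (2 powr s) * (ennreal (u x) * (G x * indicator (ccube z R) x)))"
      using H
    proof eventually_elim
      case (elim x)
      show ?case
      proof (cases "x \<in> ccube z R \<and> L \<noteq> 0")
        \<comment> \<open>If \<open>L = 0\<close>, domination forces H x = 0; otherwise |H x| / L is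
          the finite number below the potential.\<close>
        case False
        moreover have "H x = 0" if "L = 0" using elim that by simp
        ultimately show ?thesis by (cases "x \<in> ccube z R") auto
      next
        case True
        then have L': "0 < L" using L by simp
        define J where "J = (\<integral>\<^sup>+y. ennreal (F y * infnorm (x - y) powr (\<gamma> - real DIM('a))) \<partial>lborel)"
        have "ennreal (\<bar>H x\<bar> / L) = ennreal \<bar>H x\<bar> * ennreal (1 / L)"
          using L' by (simp add: ennreal_mult[symmetric])
        also have "\<dots> \<le> (ennreal L * J) * ennreal (1 / L)"
          using elim by (intro mult_right_mono) (auto simp: J_def)
        also have "\<dots> = (ennreal L * ennreal (1 / L)) * J" by (simp only: mult_ac)
        also have "ennreal L * ennreal (1 / L) = 1"
          using L' by (simp add: ennreal_mult[symmetric] del: ennreal_1 flip: ennreal_1)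
        finally have "ennreal (\<bar>H x\<bar> / L) \<le> J" by simp
        then have k: "ennreal ((\<bar>H x\<bar> / L) powr s) \<le> ennreal ((2 * T) powr s) + ennreal (2 powr s) * G x"
          using True L' unfolding J_def by (intro key) auto
        have "ennreal (\<bar>H x\<bar> powr s * u x) = (ennreal (L powr s) * ennreal (u x)) * ennreal ((\<bar>H x\<bar> / L) powr s)"
          using L' by (simp add: ennreal_mult[symmetric] powr_divide)
        also have "\<dots> \<le> (ennreal (L powr s) * ennreal (u x)) * (ennreal ((2 * T) powr s) + ennreal (2 powr s) * G x)"
          by (intro mult_left_mono k) simp
        finally show ?thesis
          using True by (simp add: distrib_left mult_ac)
      qed
    qed
    then have "(\<integral>\<^sup>+x\<in>ccube z R. ennreal (\<bar>H x\<bar> powr s * u x) \<partial>lborel)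
       \<le> (\<integral>\<^sup>+x. ennreal (L powr s) * (ennreal ((2 * T) powr s) * (ennreal (u x) * indicator (ccube z R) x)
           + ennreal (2 powr s) * (ennreal (u x) * (G x * indicator (ccube z R) x))) \<partial>lborel)"
      by (rule nn_integral_mono_AE)
    also have "\<dots> = ennreal (L powr s) * (ennreal ((2 * T) powr s) * emeasure \<mu> (ccube z R)
           + ennreal (2 powr s) * (\<integral>\<^sup>+x\<in>ccube z R. G x \<partial>\<mu>))"
      unfolding \<mu>_def by (simp add: nn_integral_cmult nn_integral_add emeasure_density nn_integral_density)
    also have "\<dots> \<le> ennreal (L powr s) * (ennreal ((2 * T) powr s) * ennreal U
           + ennreal (2 powr s) * ennreal (C' * M powr s * U powr (\<kappa> * s / p)))"
      by (intro mult_left_mono add_mono G) (auto simp: emeasure_\<mu> U_def)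
    also have "\<dots> = ennreal (L powr s * ((2 * T) powr s * U + 2 powr s * (C' * M powr s * U powr (\<kappa> * s / p))))"
      using U C' by (simp add: ennreal_mult ennreal_plus)
    also have "(2 * T) powr s * U = (2 * C) powr s * M powr s * U powr (\<kappa> * s / p)"
    proof -
      have "(\<kappa> / p - 1 / s) * s + 1 = \<kappa> * s / p" using s_pos by (simp add: field_simps)
      then have "U powr ((\<kappa> / p - 1 / s) * s) * U powr 1 = U powr (\<kappa> * s / p)"
        unfolding powr_add[symmetric] by simp
      then have "U powr ((\<kappa> / p - 1 / s) * s) * U = U powr (\<kappa> * s / p)" using U by simp
      moreover have "(2 * T) powr s = (2 * C) powr s * M powr s * U powr ((\<kappa> / p - 1 / s) * s)"
        using C M U by (simp add: T_def powr_mult powr_powr)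
      ultimately show ?thesis by simp
    qed
    also have "L powr s * ((2 * C) powr s * M powr s * U powr (\<kappa> * s / p) + 2 powr s * (C' * M powr s * U powr (\<kappa> * s / p)))
        = K * L powr s * M powr s * U powr (\<kappa> * s / p)"
      unfolding K_def by (simp only: distrib_left distrib_right mult_ac)
    finally show "(\<integral>\<^sup>+x\<in>ccube z R. ennreal (\<bar>H x\<bar> powr s * u x) \<partial>lborel)
       \<le> ennreal (K * L powr s * M powr s * measure \<mu> (ccube z R) powr (\<kappa> * s / p))"
      by (simp add: U_def)
  qed
qed

end

section \<open>Campanato characterisation of Lipschitz functions\<close>

text \<open>Integrate the smallness over all centres x in a slightly larger cube. By Tonelli each y
  is counted with the volume (2r)^n of the centres within distance r, which cancels the volume in
  the hypothesis and leaves a bound of order r^\<beta>; then r tends to 0.\<close>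

lemma AE_eq_0_if_small_on_cubes:
  fixes g :: "'a::euclidean_space \<Rightarrow> ennreal"
  assumes g [measurable]: "g \<in> borel_measurable borel" and \<beta>: "0 < \<beta>" and K: "0 \<le> K"
    and small: "\<And>x r. 0 < r \<Longrightarrow> r \<le> 1 \<Longrightarrow>
      (\<integral>\<^sup>+y\<in>ccube x r. g y \<partial>lborel) \<le> ennreal (K * r powr \<beta> * (2 * r) ^ DIM('a))"
  shows "AE y in lborel. g y = 0"
proof -
  have zero: "(\<integral>\<^sup>+y\<in>ccube 0 N. g y \<partial>lborel) = 0" if N: "0 < N" for N
  proof -
    define I where "I = (\<integral>\<^sup>+y\<in>ccube 0 N. g y \<partial>lborel)"
    define K' where "K' = K * (2 * (N + 1)) ^ DIM('a)"
    have K': "0 \<le> K'" using K N by (simp add: K'_def)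
    have le: "I \<le> ennreal (K' * r powr \<beta>)" if r: "0 < r" "r \<le> 1" for r
    proof -
      have "ennreal ((2 * r) ^ DIM('a)) * I
          = (\<integral>\<^sup>+y. \<integral>\<^sup>+x. indicator (ccube 0 N) y * g y * indicator {q. infnorm (fst q - snd q) \<le> r} (x, y) \<partial>lborel \<partial>lborel)"
      proof -
        have inner: "(\<integral>\<^sup>+x. indicator (ccube 0 N) y * g y * indicator {q. infnorm (fst q - snd q) \<le> r} (x, y) \<partial>lborel)
            = indicator (ccube 0 N) y * g y * ennreal ((2 * r) ^ DIM('a))" for y
        proof -
          have "(\<integral>\<^sup>+x. indicator {q. infnorm (fst q - snd q) \<le> r} (x, y) \<partial>lborel)
              = (\<integral>\<^sup>+x. indicator (ccube y r) x \<partial>(lborel :: 'a measure))"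
            by (intro nn_integral_cong) (simp add: indicator_def mem_ccube infnorm_sub)
          also have "\<dots> = ennreal ((2 * r) ^ DIM('a))"
            using r by (simp add: emeasure_ccube)
          finally show ?thesis
            by (subst nn_integral_cmult) auto
        qed
        show ?thesis
          unfolding I_def inner by (subst nn_integral_cmult[symmetric]) (auto simp: mult_ac)
      qed
      also have "\<dots> = (\<integral>\<^sup>+x. \<integral>\<^sup>+y. indicator (ccube 0 N) y * g y * indicator {q. infnorm (fst q - snd q) \<le> r} (x, y) \<partial>lborel \<partial>lborel)"
        by (rule lborel_pair.Fubini') measurable
      also have "\<dots> \<le> (\<integral>\<^sup>+x. ennreal (K * r powr \<beta> * (2 * r) ^ DIM('a)) * indicator (ccube 0 (N + 1)) x \<partial>(lborel :: 'a measure))"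
      proof (rule nn_integral_mono)
        fix x :: 'a
        show "(\<integral>\<^sup>+y. indicator (ccube 0 N) y * g y * indicator {q. infnorm (fst q - snd q) \<le> r} (x, y) \<partial>lborel)
            \<le> ennreal (K * r powr \<beta> * (2 * r) ^ DIM('a)) * indicator (ccube 0 (N + 1)) x"
        proof (cases "x \<in> ccube 0 (N + 1)")
          case True
          have "(\<integral>\<^sup>+y. indicator (ccube 0 N) y * g y * indicator {q. infnorm (fst q - snd q) \<le> r} (x, y) \<partial>lborel)
             \<le> (\<integral>\<^sup>+y\<in>ccube x r. g y \<partial>lborel)"
            by (intro nn_integral_mono) (auto simp: indicator_def mem_ccube)
          then show ?thesis using small[OF r, of x] True by simp
        next
          case False
          have z: "indicator (ccube 0 N) y * g y * indicator {q. infnorm (fst q - snd q) \<le> r} (x, y) = 0" for y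
          proof (rule ccontr)
            assume "\<not> ?thesis"
            then have "infnorm (0 - y) \<le> N" "infnorm (x - y) \<le> r"
              by (auto simp: indicator_def mem_ccube split: if_splits)
            then have "infnorm (0 - x) \<le> N + 1"
              using infnorm_triangle[of "0 - y" "y - x"] infnorm_sub[of y x] r by simp
            then show False using False by (simp add: mem_ccube)
          qed
          show ?thesis unfolding z by simp
        qed
      qed
      also have "\<dots> = ennreal (K * r powr \<beta> * (2 * r) ^ DIM('a)) * ennreal ((2 * (N + 1)) ^ DIM('a))"
        using N by (simp add: nn_integral_cmult emeasure_ccube)
      also have "\<dots> = ennreal ((2 * r) ^ DIM('a)) * ennreal (K' * r powr \<beta>)"
        using K N r by (simp add: K'_def ennreal_mult[symmetric] mult_ac)
      finally show ?thesis
        using r by (subst (asm) ennreal_mult_le_mult_iff) auto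
    qed
    have "I \<le> ennreal 0"
    proof (rule ennreal_le_epsilon)
      fix e :: real assume e: "0 < e"
      \<comment> \<open>Chosen so that K' r^\<beta> is at most e; the summand 1 allows K' = 0, and r
        is at most 1 so that all relevant centres lie in \<open>ccube 0 (N + 1)\<close>.\<close>
      define r where "r = min 1 ((e / (K' + 1)) powr (1 / \<beta>))"
      have r: "0 < r" "r \<le> 1" using e K' by (auto simp: r_def)
      have "r powr \<beta> \<le> ((e / (K' + 1)) powr (1 / \<beta>)) powr \<beta>"
        using r \<beta> by (intro powr_mono2) (auto simp: r_def)
      also have "\<dots> = e / (K' + 1)" using e K' \<beta> by (simp add: powr_powr)
      finally have "K' * r powr \<beta> \<le> K' * (e / (K' + 1))" using K' by (rule mult_left_mono)
      also have "\<dots> \<le> e" using e K' by (simp add: field_simps)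
      finally show "I \<le> ennreal 0 + ennreal e"
        using order_trans[OF le[OF r] ennreal_leI] by simp
    qed
    then show ?thesis by (simp add: I_def)
  qed
  have "AE y in lborel. \<forall>N::nat. g y * indicator (ccube 0 (real (Suc N))) y = 0"
    unfolding AE_all_countable
    using zero by (subst nn_integral_0_iff_AE[symmetric]) auto
  then show ?thesis
  proof eventually_elim
    case (elim y)
    obtain N :: nat where "infnorm (0 - y) \<le> real N" using real_arch_simple by blast
    then have "y \<in> ccube 0 (real (Suc N))" by (simp add: mem_ccube)
    then show ?case using elim[rule_format, of N] by simp
  qed
qed

section \<open>Averages over cubes and the Hoelder continuous representative\<close>

lemma set_integrable_ccube_const: "set_integrable lebesgue (ccube x r) (\<lambda>_. c :: real)"
  unfolding set_integrable_def
  using emeasure_lborel_cbox_finite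
  by (intro integrable_scaleR_left integrable_real_indicator) (auto simp: ccube_def)

locale campanato =
  fixes b :: "'a::euclidean_space \<Rightarrow> real" and \<beta> L :: real
  assumes b_int: "loc_int b" and \<beta>: "0 < \<beta>" and L: "0 \<le> L"
    and osc: "\<And>x r. 0 < r \<Longrightarrow> (LINT y:ccube x r|lebesgue. \<bar>b y - avg b (ccube x r)\<bar>)
      \<le> L * (2 * r) powr \<beta> * (2 * r) ^ DIM('a)"
begin

lemma b_int_ccube: "0 < r \<Longrightarrow> set_integrable lebesgue (ccube x r) b"
  using b_int cube_ccube by (auto simp: loc_int_def)

lemma b_diff_int_ccube: "0 < r \<Longrightarrow> set_integrable lebesgue (ccube x r) (\<lambda>y. b y - c)"
  by (intro set_integral_diff b_int_ccube set_integrable_ccube_const)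

text \<open>The mean oscillation about a fixed constant over a subcube is at most the volume ratio
  times that over the large cube. Concentric and off-centre subcubes both occur below.\<close>

lemma avg_diff:
  assumes r: "0 < r" "0 < r'" and sub: "ccube y r' \<subseteq> ccube x r"
  shows "\<bar>avg b (ccube y r') - avg b (ccube x r)\<bar> \<le> (r / r') ^ DIM('a) * (L * (2 * r) powr \<beta>)"
proof -
  define c where "c = avg b (ccube x r)"
  have "\<bar>avg b (ccube y r') - c\<bar> * (2 * r') ^ DIM('a) = \<bar>LINT z:ccube y r'|lebesgue. b z - c\<bar>"
  proof -
    have "(LINT z:ccube y r'|lebesgue. b z - c) = wmeas b (ccube y r') - (LINT z:ccube y r'|lebesgue. c)"
      unfolding wmeas_def using r by (intro set_integral_diff b_int_ccube set_integrable_ccube_const)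
    also have "(LINT z:ccube y r'|lebesgue. c) = (2 * r') ^ DIM('a) * c"
      using r by (simp add: set_lebesgue_integral_def content_ccube)
    also have "wmeas b (ccube y r') - (2 * r') ^ DIM('a) * c = (avg b (ccube y r') - c) * (2 * r') ^ DIM('a)"
      using r by (simp add: avg_def content_ccube left_diff_distrib)
    finally show ?thesis using r by (simp add: abs_mult)
  qed
  also have "\<dots> \<le> (LINT z:ccube y r'|lebesgue. \<bar>b z - c\<bar>)"
    unfolding set_lebesgue_integral_def
    by (rule order_trans[OF integral_abs_bound]) (simp add: abs_mult)
  also have "\<dots> \<le> (LINT z:ccube x r|lebesgue. \<bar>b z - c\<bar>)"
    unfolding set_lebesgue_integral_def
    using b_diff_int_ccube[OF r(1), of x c, THEN set_integrable_abs]
      b_diff_int_ccube[OF r(2), of y c, THEN set_integrable_abs] sub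
    by (intro integral_mono) (auto simp: set_integrable_def indicator_def)
  also have "\<dots> \<le> L * (2 * r) powr \<beta> * (2 * r) ^ DIM('a)"
    unfolding c_def by (rule osc[OF r(1)])
  finally have "\<bar>avg b (ccube y r') - c\<bar> \<le> L * (2 * r) powr \<beta> * (2 * r) ^ DIM('a) / (2 * r') ^ DIM('a)"
    using r by (simp add: field_simps)
  also have "\<dots> = (r / r') ^ DIM('a) * (L * (2 * r) powr \<beta>)"
    using r by (simp add: power_mult_distrib power_divide)
  finally show ?thesis by (simp add: c_def)
qed

text \<open>Sum of a geometric series: the first halving of a radius costs 2^n 2^\<beta>, and each
  further one 2^(-\<beta>) times the one before.\<close>

definition osc_const :: real where "osc_const = 2 ^ DIM('a) * 2 powr \<beta> / (1 - 2 powr (- \<beta>))"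

lemma osc_const_pos: "0 < osc_const" and osc_const_eq: "osc_const * 2 powr (- \<beta>) + 2 ^ DIM('a) * 2 powr \<beta> = osc_const"
proof -
  have "2 powr (- \<beta>) < (1::real)" using \<beta> by (simp add: powr_less_one)
  then show "0 < osc_const" by (simp add: osc_const_def)
  have "osc_const * (1 - 2 powr (- \<beta>)) = 2 ^ DIM('a) * 2 powr \<beta>"
    using \<open>2 powr (- \<beta>) < 1\<close> \<beta> by (simp add: osc_const_def)
  then show "osc_const * 2 powr (- \<beta>) + 2 ^ DIM('a) * 2 powr \<beta> = osc_const"
    unfolding right_diff_distrib by linarith
qed

text \<open>Halve \<open>r\<close> until it is within a factor 2 of \<open>t\<close>. Each halving
  is one use of \<open>avg_diff\<close>, and the costs decrease geometrically; the induction runs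
  over the number of halvings with \<open>t\<close> fixed.\<close>

lemma avg_diff_same_centre:
  assumes t: "0 < t" "t \<le> r"
  shows "\<bar>avg b (ccube x t) - avg b (ccube x r)\<bar> \<le> osc_const * L * r powr \<beta>"
proof -
  have step: "\<bar>avg b (ccube x t) - avg b (ccube x r)\<bar> \<le> 2 ^ DIM('a) * 2 powr \<beta> * (L * r powr \<beta>)"
    if "0 < t" "t \<le> r" "r \<le> 2 * t" for r t
  proof -
    have "\<bar>avg b (ccube x t) - avg b (ccube x r)\<bar> \<le> (r / t) ^ DIM('a) * (L * (2 * r) powr \<beta>)"
      using that by (intro avg_diff ccube_mono_radius) auto
    also have "\<dots> \<le> 2 ^ DIM('a) * (L * (2 * r) powr \<beta>)"
      using that L by (intro mult_right_mono power_mono) (auto simp: field_simps)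
    finally show ?thesis using that by (simp add: powr_mult mult_ac)
  qed
  have main: "\<bar>avg b (ccube x t) - avg b (ccube x r)\<bar> \<le> osc_const * L * r powr \<beta>"
    if "t \<le> r" "r \<le> 2 ^ j * t" for r and j :: nat
    using that
  proof (induction j arbitrary: r)
    case 0
    then have "r = t" by simp
    then show ?case using osc_const_pos L by simp
  next
    case (Suc j)
    have osc_const_ge: "2 ^ DIM('a) * 2 powr \<beta> * (L * r powr \<beta>) \<le> osc_const * L * r powr \<beta>"
    proof -
      have "2 ^ DIM('a) * 2 powr \<beta> \<le> osc_const"
        using osc_const_eq mult_pos_pos[OF osc_const_pos, of "2 powr (- \<beta>)"] by simp
      then have "2 ^ DIM('a) * 2 powr \<beta> * (L * r powr \<beta>) \<le> osc_const * (L * r powr \<beta>)"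
        using L by (intro mult_right_mono) auto
      then show ?thesis by (simp add: mult.assoc)
    qed
    show ?case
    proof (cases "r \<le> 2 * t")
      case True
      then show ?thesis using step[of t r] t Suc osc_const_ge by linarith
    next
      case False
      have "\<bar>avg b (ccube x t) - avg b (ccube x (r / 2))\<bar> \<le> osc_const * L * (r / 2) powr \<beta>"
        using False Suc by (intro Suc.IH) auto
      moreover have "\<bar>avg b (ccube x (r / 2)) - avg b (ccube x r)\<bar> \<le> 2 ^ DIM('a) * 2 powr \<beta> * (L * r powr \<beta>)"
        using False t by (intro step) auto
      moreover have "osc_const * L * (r / 2) powr \<beta> + 2 ^ DIM('a) * 2 powr \<beta> * (L * r powr \<beta>) = osc_const * L * r powr \<beta>"
      proof -
        have "osc_const * L * (r / 2) powr \<beta> + 2 ^ DIM('a) * 2 powr \<beta> * (L * r powr \<beta>)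
            = (osc_const * 2 powr (- \<beta>) + 2 ^ DIM('a) * 2 powr \<beta>) * (L * r powr \<beta>)"
          using False t by (simp add: powr_divide powr_minus field_simps)
        then show ?thesis unfolding osc_const_eq by (simp add: mult.assoc)
      qed
      ultimately show ?thesis by linarith
    qed
  qed
  obtain j :: nat where "r / t < 2 ^ j" using real_arch_pow[of 2 "r / t"] by auto
  then have "r \<le> 2 ^ j * t" using t by (simp add: field_simps)
  then show ?thesis using main t by blast
qed

text \<open>The rate in \<open>avg_diff_same_centre\<close> makes this limit exist at every point,
  not merely at almost every one, which is why Hoelder continuity can be claimed everywhere.\<close>

definition b0 :: "'a \<Rightarrow> real" where "b0 x = lim (\<lambda>m. avg b (ccube x (1 / real (Suc m))))"

lemma avg_tendsto_b0: "(\<lambda>m. avg b (ccube x (1 / real (Suc m)))) \<longlonglongrightarrow> b0 x"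
proof -
  have "Cauchy (\<lambda>m. avg b (ccube x (1 / real (Suc m))))"
  proof (rule CauchyI')
    fix e :: real assume e: "0 < e"
    \<comment> \<open>Makes \<open>osc_const * L * r powr \<beta>\<close> less than e/2; the summand
      1 provides for L = 0.\<close>
    define r where "r = (e / (2 * osc_const * L + 1)) powr (1 / \<beta>)"
    have AL: "0 \<le> osc_const * L" using osc_const_pos L by simp
    have r: "0 < r" using e AL by (simp add: r_def add_nonneg_pos)
    have "r powr \<beta> = e / (2 * osc_const * L + 1)"
      using e AL \<beta> by (simp add: r_def powr_powr add_nonneg_pos)
    then have "osc_const * L * r powr \<beta> = osc_const * L * e / (2 * (osc_const * L) + 1)" by (simp add: mult_ac)
    also have "\<dots> < e / 2"
    proof -
      have "osc_const * L * e * 2 < e * (2 * (osc_const * L) + 1)" using e by (simp add: algebra_simps)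
      then show ?thesis using AL by (simp add: pos_divide_less_eq add_nonneg_pos field_simps)
    qed
    finally have small: "osc_const * L * r powr \<beta> < e / 2" .
    obtain N where N: "1 / real (Suc N) < r" using nat_approx_posE[OF r] by blast
    have near: "\<bar>avg b (ccube x (1 / real (Suc m))) - avg b (ccube x r)\<bar> < e / 2" if "m \<ge> N" for m
    proof -
      have "1 / real (Suc m) \<le> 1 / real (Suc N)" using that by (simp add: frac_le)
      then show ?thesis
        using N small avg_diff_same_centre[of "1 / real (Suc m)" r x] by force
    qed
    show "\<exists>M. \<forall>m\<ge>M. \<forall>n>m. dist (avg b (ccube x (1 / real (Suc m)))) (avg b (ccube x (1 / real (Suc n)))) < e"
    proof (intro exI[of _ N] allI impI)
      fix m n assume "N \<le> m" "m < n"
      then show "dist (avg b (ccube x (1 / real (Suc m)))) (avg b (ccube x (1 / real (Suc n)))) < e"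
        using near[of m] near[of n] unfolding dist_real_def by linarith
    qed
  qed
  then show ?thesis
    unfolding b0_def by (simp only: Cauchy_convergent_iff convergent_LIMSEQ_iff)
qed

lemma b0_avg:
  assumes r: "0 < r" shows "\<bar>b0 x - avg b (ccube x r)\<bar> \<le> osc_const * L * r powr \<beta>"
proof (rule tendsto_upperbound)
  show "(\<lambda>m. \<bar>avg b (ccube x (1 / real (Suc m))) - avg b (ccube x r)\<bar>) \<longlonglongrightarrow> \<bar>b0 x - avg b (ccube x r)\<bar>"
    by (intro tendsto_intros avg_tendsto_b0)
  obtain N where N: "1 / real (Suc N) < r" using nat_approx_posE[OF r] by blast
  show "\<forall>\<^sub>F m in sequentially. \<bar>avg b (ccube x (1 / real (Suc m))) - avg b (ccube x r)\<bar> \<le> osc_const * L * r powr \<beta>"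
    using eventually_ge_at_top[of N]
  proof eventually_elim
    case (elim m)
    then have "1 / real (Suc m) \<le> 1 / real (Suc N)" by (simp add: frac_le)
    then show ?case using N by (intro avg_diff_same_centre) auto
  qed
qed simp

text \<open>The terms in \<open>osc_const\<close> come from replacing \<open>b0\<close> by averages
  at x and at y; the rest comes from comparing both cubes of radius r = |x-y| with the cube about x
  of radius 2r, each comparison costing 2^n 4^\<beta>.\<close>

definition holder_const :: real where "holder_const = 2 * osc_const + 2 * 2 ^ DIM('a) * 4 powr \<beta>"

lemma holder_const_pos: "0 < holder_const" using osc_const_pos by (simp add: holder_const_def add_pos_pos)

lemma b0_Holder: "\<bar>b0 x - b0 y\<bar> \<le> holder_const * L * infnorm (x - y) powr \<beta>"
proof (cases "x = y")
  case False
  define r where "r = infnorm (x - y)"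
  have r: "0 < r" using False by (simp add: r_def infnorm_pos_lt)
  have "\<bar>avg b (ccube x r) - avg b (ccube x (2 * r))\<bar> \<le> (2 * r / r) ^ DIM('a) * (L * (2 * (2 * r)) powr \<beta>)"
    using r by (intro avg_diff ccube_mono_radius) auto
  moreover have "\<bar>avg b (ccube y r) - avg b (ccube x (2 * r))\<bar> \<le> (2 * r / r) ^ DIM('a) * (L * (2 * (2 * r)) powr \<beta>)"
    using r by (intro avg_diff ccube_mono) (auto simp: r_def infnorm_sub)
  moreover have "(2 * r / r) ^ DIM('a) * (L * (2 * (2 * r)) powr \<beta>) = 2 ^ DIM('a) * 4 powr \<beta> * (L * r powr \<beta>)"
  proof -
    have "(2 * (2 * r)) powr \<beta> = 4 powr \<beta> * r powr \<beta>"
      using r by (simp add: powr_mult[symmetric])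
    then show ?thesis using r by simp
  qed
  moreover have "holder_const * L * r powr \<beta> = 2 * (osc_const * L * r powr \<beta>) + 2 * (2 ^ DIM('a) * 4 powr \<beta> * (L * r powr \<beta>))"
    by (simp add: holder_const_def algebra_simps)
  ultimately show ?thesis
    using b0_avg[OF r, of x] b0_avg[OF r, of y] unfolding r_def[symmetric] by linarith
qed (use holder_const_pos L in simp)

lemma b0_continuous: "continuous_on UNIV b0"
  unfolding continuous_on_def
proof
  fix x
  have "((\<lambda>y. b0 y - b0 x) \<longlongrightarrow> 0) (at x)"
  proof (rule Lim_null_comparison)
    show "\<forall>\<^sub>F y in at x. norm (b0 y - b0 x) \<le> holder_const * L * infnorm (y - x) powr \<beta>"
      using b0_Holder by (auto intro: always_eventually)
    have "((\<lambda>y. infnorm (y - x) powr \<beta>) \<longlongrightarrow> infnorm (x - x) powr \<beta>) (at x)"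
      using \<beta> by (intro tendsto_intros) (auto simp: infnorm_pos_le)
    then have "((\<lambda>y. holder_const * L * infnorm (y - x) powr \<beta>) \<longlongrightarrow> holder_const * L * (infnorm (x - x) powr \<beta>)) (at x)"
      by (rule tendsto_mult_left)
    then show "((\<lambda>y. holder_const * L * infnorm (y - x) powr \<beta>) \<longlongrightarrow> 0) (at x)"
      using \<beta> by (simp add: infnorm_0)
  qed
  then show "(b0 \<longlongrightarrow> b0 x) (at x)" by (simp add: LIM_zero_iff)
qed

text \<open>On a cube about x, compare b with its average, the average with b0(x), and b0(x) with
  b0(y). All three differences have mean of order r^\<beta>, which forces b - b0 to vanish almost
  everywhere.\<close>

lemma b_eq_b0: "AE y in lebesgue. b y = b0 y"
proof -
  obtain b' where b' [measurable]: "b' \<in> borel_measurable borel" and b'_eq: "AE y in lborel. b y = b' y"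
    using completion_ex_borel_measurable_real[of b lborel] b_int by (auto simp: loc_int_def)
  have [measurable]: "b0 \<in> borel_measurable borel"
    by (intro borel_measurable_continuous_onI b0_continuous)
  define K where "K = L * 2 powr \<beta> + osc_const * L + holder_const * L"
  have K: "0 \<le> K" using osc_const_pos holder_const_pos L by (simp add: K_def)
  have "AE y in lborel. ennreal \<bar>b' y - b0 y\<bar> = 0"
  proof (rule AE_eq_0_if_small_on_cubes[OF _ \<beta> K])
    fix x :: 'a and r :: real assume r: "0 < r"
    define c where "c = avg b (ccube x r)"
    have pw: "\<bar>b y - b0 y\<bar> \<le> \<bar>b y - c\<bar> + (osc_const * L + holder_const * L) * r powr \<beta>" if "y \<in> ccube x r" for y
    proof -
      have "infnorm (x - y) powr \<beta> \<le> r powr \<beta>"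
        using that \<beta> by (intro powr_mono2) (auto simp: mem_ccube infnorm_pos_le)
      then have "holder_const * L * infnorm (x - y) powr \<beta> \<le> holder_const * L * r powr \<beta>"
        using holder_const_pos L by (intro mult_left_mono) auto
      then show ?thesis
        using b0_avg[OF r, of x] b0_Holder[of x y] unfolding c_def[symmetric] distrib_right by linarith
    qed
    have int: "set_integrable lebesgue (ccube x r) (\<lambda>y. \<bar>b y - c\<bar> + (osc_const * L + holder_const * L) * r powr \<beta>)"
      using r by (intro set_integral_add set_integrable_abs b_diff_int_ccube set_integrable_ccube_const)
    have "(\<integral>\<^sup>+y\<in>ccube x r. ennreal \<bar>b' y - b0 y\<bar> \<partial>lborel) = (\<integral>\<^sup>+y\<in>ccube x r. ennreal \<bar>b y - b0 y\<bar> \<partial>lborel)"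
      using b'_eq by (intro nn_integral_cong_AE) (auto elim: eventually_mono)
    also have "\<dots> = (\<integral>\<^sup>+y\<in>ccube x r. ennreal \<bar>b y - b0 y\<bar> \<partial>lebesgue)"
      by (simp add: nn_integral_completion)
    also have "\<dots> \<le> (\<integral>\<^sup>+y. ennreal (indicator (ccube x r) y *\<^sub>R (\<bar>b y - c\<bar> + (osc_const * L + holder_const * L) * r powr \<beta>)) \<partial>lebesgue)"
      using pw by (intro nn_integral_mono) (auto simp: indicator_def intro!: ennreal_leI)
    also have "\<dots> = ennreal (LINT y:ccube x r|lebesgue. \<bar>b y - c\<bar> + (osc_const * L + holder_const * L) * r powr \<beta>)"
      unfolding set_lebesgue_integral_def
      using int osc_const_pos holder_const_pos L by (intro nn_integral_eq_integral) (auto simp: set_integrable_def)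
    also have "(LINT y:ccube x r|lebesgue. \<bar>b y - c\<bar> + (osc_const * L + holder_const * L) * r powr \<beta>)
        = (LINT y:ccube x r|lebesgue. \<bar>b y - c\<bar>) + (LINT y:ccube x r|lebesgue. (osc_const * L + holder_const * L) * r powr \<beta>)"
      using r by (intro set_integral_add set_integrable_abs b_diff_int_ccube set_integrable_ccube_const)
    also have "(LINT y:ccube x r|lebesgue. (osc_const * L + holder_const * L) * r powr \<beta>) = (osc_const * L + holder_const * L) * r powr \<beta> * (2 * r) ^ DIM('a)"
      using r by (simp add: set_lebesgue_integral_def content_ccube)
    also have "ennreal ((LINT y:ccube x r|lebesgue. \<bar>b y - c\<bar>) + (osc_const * L + holder_const * L) * r powr \<beta> * (2 * r) ^ DIM('a))
      \<le> ennreal (L * (2 * r) powr \<beta> * (2 * r) ^ DIM('a) + (osc_const * L + holder_const * L) * r powr \<beta> * (2 * r) ^ DIM('a))"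
      unfolding c_def by (intro ennreal_leI add_right_mono osc r)
    also have "L * (2 * r) powr \<beta> * (2 * r) ^ DIM('a) + (osc_const * L + holder_const * L) * r powr \<beta> * (2 * r) ^ DIM('a)
      = K * r powr \<beta> * (2 * r) ^ DIM('a)"
      using r unfolding K_def by (simp add: powr_mult distrib_right)
    finally show "(\<integral>\<^sup>+y\<in>ccube x r. ennreal \<bar>b' y - b0 y\<bar> \<partial>lborel) \<le> ennreal (K * r powr \<beta> * (2 * r) ^ DIM('a))" .
  qed measurable
  then have "AE y in lborel. b y = b0 y"
    using b'_eq by eventually_elim simp
  then show ?thesis by (rule AE_completion)
qed

end

section \<open>The commutator\<close>

lemma cubes_nonempty: "Collect (cube :: 'a::euclidean_space set \<Rightarrow> bool) \<noteq> {}"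
  using cube_ccube[of 1 "0::'a"] by auto

lemma campanato_lip_norm:
  fixes b :: "'a::euclidean_space \<Rightarrow> real"
  assumes b: "lip_space \<beta> b" and \<beta>: "0 < \<beta>"
  shows "campanato b \<beta> (lip_norm \<beta> b)"
proof
  have le: "lip_osc \<beta> b Q \<le> lip_norm \<beta> b" if "cube Q" for Q
    unfolding lip_norm_def using b that by (intro cSUP_upper) (auto simp: lip_space_def)
  show "loc_int b" using b by (simp add: lip_space_def)
  have nn: "0 \<le> (LINT y:Q|lebesgue. \<bar>b y - avg b Q\<bar>)" for Q
    unfolding set_lebesgue_integral_def by (rule Bochner_Integration.integral_nonneg) simp
  have "0 \<le> lip_osc \<beta> b (ccube 0 1)" using nn by (simp add: lip_osc_def)
  then show "0 \<le> lip_norm \<beta> b" using le[OF cube_ccube[of 1 0]] by simp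
  fix x :: 'a and r :: real assume r: "0 < r"
  define I where "I = (LINT y:ccube x r|lebesgue. \<bar>b y - avg b (ccube x r)\<bar>)"
  have "((2 * r) ^ DIM('a)) powr (\<beta> / real DIM('a)) = (2 * r) powr \<beta>"
    using r by (subst powr_realpow[symmetric]) (auto simp: powr_powr)
  then have "1 / (2 * r) powr \<beta> * (1 / (2 * r) ^ DIM('a)) * I \<le> lip_norm \<beta> b"
    using le[OF cube_ccube[OF r, of x]] unfolding lip_osc_def I_def[symmetric] measure_lebesgue_ccube[OF less_imp_le[OF r]]
    by simp
  moreover have "0 < (2 * r) powr \<beta> * (2 * r) ^ DIM('a)" using r by simp
  ultimately show "(LINT y:ccube x r|lebesgue. \<bar>b y - avg b (ccube x r)\<bar>)
      \<le> lip_norm \<beta> b * (2 * r) powr \<beta> * (2 * r) ^ DIM('a)"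
    unfolding I_def[symmetric] using r by (simp add: pos_divide_le_eq mult.assoc del: power_mult_distrib)
qed (rule \<beta>)

text \<open>No integrability is assumed: if \<open>g\<close> is not integrable and \<open>c \<noteq> 0\<close>, then finiteness of the
  right-hand side forces \<open>b * g\<close> not to be integrable either, and both integrals are \<open>0\<close>.\<close>

lemma integral_commutator_bound:
  fixes g b :: "'b \<Rightarrow> real"
  assumes [measurable]: "g \<in> borel_measurable M" "b \<in> borel_measurable M"
  shows "ennreal \<bar>c * (LINT y|M. g y) - (LINT y|M. b y * g y)\<bar> \<le> (\<integral>\<^sup>+y. ennreal \<bar>(c - b y) * g y\<bar> \<partial>M)"
proof (cases "(\<integral>\<^sup>+y. ennreal \<bar>(c - b y) * g y\<bar> \<partial>M) = \<infinity>")
  case False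
  then have D: "integrable M (\<lambda>y. (c - b y) * g y)"
    by (intro integrableI_bounded) (auto simp: less_top)
  have D_le: "ennreal \<bar>LINT y|M. (c - b y) * g y\<bar> \<le> (\<integral>\<^sup>+y. ennreal \<bar>(c - b y) * g y\<bar> \<partial>M)"
    using integral_norm_bound_ennreal[OF D] by simp
  show ?thesis
  proof (cases "integrable M g")
    case g: True
    have "integrable M (\<lambda>y. c * g y - (c - b y) * g y)"
      by (intro Bochner_Integration.integrable_diff D integrable_mult_right g)
    then have "integrable M (\<lambda>y. b y * g y)" by (simp add: algebra_simps)
    then have "(LINT y|M. (c - b y) * g y) = c * (LINT y|M. g y) - (LINT y|M. b y * g y)"
      using g by (simp add: left_diff_distrib)
    then show ?thesis using D_le by simp
  next
    case g: False
    show ?thesis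
    proof (cases "c = 0")
      \<comment> \<open>For c = 0 the two integrands differ only in sign, so this is the usual bound
        for a single integral.\<close>
      case True
      then show ?thesis using D_le by simp
    next
      case c: False
      have "\<not> integrable M (\<lambda>y. b y * g y)"
      proof
        assume "integrable M (\<lambda>y. b y * g y)"
        then have "integrable M (\<lambda>y. (1 / c) * ((c - b y) * g y + b y * g y))"
          by (intro integrable_mult_right Bochner_Integration.integrable_add D)
        moreover have "(1 / c) * ((c - b y) * g y + b y * g y) = g y" for y
          using c by (simp add: left_diff_distrib)
        ultimately show False using g by simp
      qed
      then show ?thesis using g by (simp add: not_integrable_integral_eq)
    qed
  qed
qed simp

section \<open>Measurability and pointwise domination of the commutator\<close>

lemma riesz_kernel_meas:
  "(\<lambda>y. norm (x - y) powr a) \<in> borel_measurable (lebesgue :: 'a::euclidean_space measure)"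
proof -
  have "(\<lambda>y. norm (x - y) powr a) \<in> borel_measurable (lborel :: 'a measure)" by measurable
  then show ?thesis by (rule measurable_completion)
qed

text \<open>Changing \<open>f\<close> on a null set alters the integral at no point x, so a Borel
  version may be used. Its integrand is jointly Borel in x and y, and the parameter integral is then
  Borel, with the default value 0 where it does not converge.\<close>

lemma frac_int_measurable:
  fixes f :: "'a::euclidean_space \<Rightarrow> real"
  assumes f: "f \<in> borel_measurable lebesgue"
  shows "frac_int c \<alpha> f \<in> borel_measurable lebesgue"
proof -
  obtain f' where [measurable]: "f' \<in> borel_measurable borel" and eq: "AE y in lborel. f y = f' y"
    using completion_ex_borel_measurable_real[of f lborel] f by auto
  have "frac_int c \<alpha> f x = c * (LINT y|lborel. f' y / norm (x - y) powr (real DIM('a) - \<alpha>))" for x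
  proof -
    have "(LINT y|lebesgue. f y / norm (x - y) powr (real DIM('a) - \<alpha>))
        = (LINT y|lebesgue. f' y / norm (x - y) powr (real DIM('a) - \<alpha>))"
    proof (rule integral_cong_AE)
      show "AE y in lebesgue. f y / norm (x - y) powr (real DIM('a) - \<alpha>)
          = f' y / norm (x - y) powr (real DIM('a) - \<alpha>)"
        using AE_completion[OF eq] by eventually_elim simp
      have "f' \<in> borel_measurable lebesgue" by (rule measurable_completion) measurable
      then show "(\<lambda>y. f' y / norm (x - y) powr (real DIM('a) - \<alpha>)) \<in> borel_measurable lebesgue"
        by (intro borel_measurable_divide riesz_kernel_meas)
    qed (intro borel_measurable_divide riesz_kernel_meas f)
    also have "\<dots> = (LINT y|lborel. f' y / norm (x - y) powr (real DIM('a) - \<alpha>))"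
      by (rule integral_completion) measurable
    finally show ?thesis by (simp add: frac_int_def)
  qed
  moreover have "(\<lambda>x. c * (LINT y|lborel. f' y / norm (x - y) powr (real DIM('a) - \<alpha>))) \<in> borel_measurable borel"
    by measurable
  ultimately have "frac_int c \<alpha> f \<in> borel_measurable borel"
    by (subst measurable_cong) auto
  then show ?thesis by (intro measurable_completion) simp
qed

lemma commutator_measurable:
  fixes f :: "'a::euclidean_space \<Rightarrow> real"
  assumes "f \<in> borel_measurable lebesgue" "b \<in> borel_measurable lebesgue"
  shows "commutator b c \<alpha> f \<in> borel_measurable lebesgue"
  unfolding commutator_def[abs_def]
  using assms by (intro borel_measurable_diff borel_measurable_times frac_int_measurable)

lemma lip_space_Holder:
  fixes b :: "'a::euclidean_space \<Rightarrow> real"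
  assumes b: "lip_space \<beta> b" and \<beta>: "0 < \<beta>"
  shows "\<exists>K>0. \<exists>b0. (AE x in lborel. b x = b0 x) \<and>
    (\<forall>x y. \<bar>b0 x - b0 y\<bar> \<le> K * lip_norm \<beta> b * infnorm (x - y) powr \<beta>)"
proof -
  interpret campanato b \<beta> "lip_norm \<beta> b" by (rule campanato_lip_norm[OF assms])
  have "AE x in lborel. b x = b0 x" using b_eq_b0 by (simp add: AE_completion_iff)
  then show ?thesis using holder_const_pos b0_Holder by blast
qed

lemma lip_norm_nonneg:
  assumes "lip_space \<beta> b" "0 < \<beta>" shows "0 \<le> lip_norm \<beta> b"
  using campanato_lip_norm[OF assms] by (simp add: campanato_def)

text \<open>Formally the commutator integrates (b(x) - b(y)) f(y) against the kernel, and Hoelder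
  continuity raises the order of the potential by \<beta>. Points where b and b0 differ are
  discarded, first for x and then for y.\<close>

lemma commutator_pointwise_bound:
  fixes b b0 f :: "'a::euclidean_space \<Rightarrow> real"
  assumes b [measurable]: "b \<in> borel_measurable lebesgue" and f [measurable]: "f \<in> borel_measurable lebesgue"
    and eq: "AE x in lborel. b x = b0 x"
    and Holder: "\<And>x y. \<bar>b0 x - b0 y\<bar> \<le> K * infnorm (x - y) powr \<beta>"
    and K: "0 \<le> K" and \<alpha>: "\<alpha> < real DIM('a)" and c: "0 < c"
  shows "AE x in lborel. ennreal \<bar>commutator b c \<alpha> f x\<bar> \<le> ennreal (c * K) *
    (\<integral>\<^sup>+y. ennreal (\<bar>f y\<bar> * infnorm (x - y) powr (\<alpha> + \<beta> - real DIM('a))) \<partial>lborel)"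
  using eq
proof eventually_elim
  case x: (elim x)
  define g where "g = (\<lambda>y. f y / norm (x - y) powr (real DIM('a) - \<alpha>))"
  have g [measurable]: "g \<in> borel_measurable lebesgue"
    unfolding g_def by (intro borel_measurable_divide riesz_kernel_meas f)
  have k_meas: "(\<lambda>y. infnorm (x - y) powr (\<alpha> + \<beta> - real DIM('a))) \<in> borel_measurable lebesgue"
    by (rule measurable_completion) measurable
  have comm: "commutator b c \<alpha> f x = c * (b x * (LINT y|lebesgue. g y) - (LINT y|lebesgue. b y * g y))"
    by (simp add: commutator_def frac_int_def g_def right_diff_distrib mult_ac)
  have "ennreal \<bar>commutator b c \<alpha> f x\<bar>
      = ennreal c * ennreal \<bar>b x * (LINT y|lebesgue. g y) - (LINT y|lebesgue. b y * g y)\<bar>"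
    unfolding comm using c by (simp add: abs_mult ennreal_mult)
  also have "\<dots> \<le> ennreal c * (\<integral>\<^sup>+y. ennreal \<bar>(b x - b y) * g y\<bar> \<partial>lebesgue)"
    by (intro mult_left_mono integral_commutator_bound g b) simp
  also have "(\<integral>\<^sup>+y. ennreal \<bar>(b x - b y) * g y\<bar> \<partial>lebesgue)
      \<le> (\<integral>\<^sup>+y. ennreal K * ennreal (\<bar>f y\<bar> * infnorm (x - y) powr (\<alpha> + \<beta> - real DIM('a))) \<partial>lebesgue)"
  proof (rule nn_integral_mono_AE)
    show "AE y in lebesgue. ennreal \<bar>(b x - b y) * g y\<bar>
        \<le> ennreal K * ennreal (\<bar>f y\<bar> * infnorm (x - y) powr (\<alpha> + \<beta> - real DIM('a)))"
      using AE_completion[OF eq] AE_completion[OF AE_lborel_singleton[of x]]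
    proof eventually_elim
      case (elim y)
      define r where "r = infnorm (x - y)"
      have r: "0 < r" using elim by (simp add: r_def infnorm_pos_lt)
      have rn: "r \<le> norm (x - y)" by (simp add: r_def infnorm_le_norm)
      have "\<bar>(b x - b y) * g y\<bar> = \<bar>b0 x - b0 y\<bar> * (\<bar>f y\<bar> * norm (x - y) powr (- (real DIM('a) - \<alpha>)))"
        unfolding powr_minus using elim x by (simp add: g_def abs_mult divide_inverse)
      \<comment> \<open>The exponent \<alpha> - n is negative and \<open>infnorm\<close> is at most
        the Euclidean norm, so passing to the supremum norm enlarges the kernel.\<close>
      also have "\<dots> \<le> (K * r powr \<beta>) * (\<bar>f y\<bar> * r powr (- (real DIM('a) - \<alpha>)))"
        using Holder[of x y] r rn \<alpha> K unfolding r_def[symmetric]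
        by (intro mult_mono mult_left_mono powr_mono2') auto
      also have "\<dots> = K * (\<bar>f y\<bar> * (r powr \<beta> * r powr (- (real DIM('a) - \<alpha>))))"
        by (simp only: mult_ac)
      also have "r powr \<beta> * r powr (- (real DIM('a) - \<alpha>)) = r powr (\<alpha> + \<beta> - real DIM('a))"
        unfolding powr_add[symmetric] by (simp add: algebra_simps)
      finally show ?case
        using K by (simp add: r_def ennreal_mult[symmetric] ennreal_leI)
    qed
  qed
  also have "\<dots> = ennreal K * (\<integral>\<^sup>+y. ennreal (\<bar>f y\<bar> * infnorm (x - y) powr (\<alpha> + \<beta> - real DIM('a))) \<partial>lebesgue)"
    by (intro nn_integral_cmult measurable_compose[OF _ measurable_ennreal] borel_measurable_times
        borel_measurable_abs f k_meas)
  also have "\<dots> = ennreal K * (\<integral>\<^sup>+y. ennreal (\<bar>f y\<bar> * infnorm (x - y) powr (\<alpha> + \<beta> - real DIM('a))) \<partial>lborel)"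
    by (simp add: nn_integral_completion)
  finally show ?case
    using c K by (simp add: ennreal_mult mult_left_mono mult.assoc)
qed

text \<open>Bridge between the Bochner integrals over \<open>lebesgue\<close> in the definitions and
  the Borel densities with which the potential is estimated.\<close>

lemma emeasure_density_eq_set_integral:
  fixes g h :: "'a::euclidean_space \<Rightarrow> real"
  assumes h: "h \<in> borel_measurable borel" and eq: "AE x in lborel. g x = h x"
    and nn: "AE x in lborel. 0 \<le> g x" and int: "set_integrable lebesgue (ccube z r) g"
  shows "emeasure (density lborel (\<lambda>x. ennreal (h x))) (ccube z r)
    = ennreal (LINT x:ccube z r|lebesgue. g x)"
proof -
  have "emeasure (density lborel (\<lambda>x. ennreal (h x))) (ccube z r)
      = (\<integral>\<^sup>+x. ennreal (h x) * indicator (ccube z r) x \<partial>lborel)"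
    using h by (subst emeasure_density) auto
  also have "\<dots> = (\<integral>\<^sup>+x. ennreal (indicator (ccube z r) x *\<^sub>R g x) \<partial>lborel)"
    using eq by (intro nn_integral_cong_AE) (auto elim!: eventually_mono simp: indicator_def)
  also have "\<dots> = (\<integral>\<^sup>+x. ennreal (indicator (ccube z r) x *\<^sub>R g x) \<partial>lebesgue)"
    by (simp add: nn_integral_completion)
  also have "\<dots> = ennreal (LINT x:ccube z r|lebesgue. g x)"
    unfolding set_lebesgue_integral_def
  proof (rule nn_integral_eq_integral)
    show "AE x in lebesgue. 0 \<le> indicator (ccube z r) x *\<^sub>R g x"
      using AE_completion[OF nn] by eventually_elim simp
  qed (use int in \<open>simp add: set_integrable_def\<close>)
  finally show ?thesis .
qed

lemma A1_borel_version:
  fixes v :: "'a::euclidean_space \<Rightarrow> real"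
  assumes "A1 v"
  obtains u C where "u \<in> borel_measurable borel" "\<And>x. 0 < u x" "AE x in lborel. v x = u x" "0 < C"
    "\<And>x r. emeasure (density lborel (\<lambda>x. ennreal (u x))) (ccube x r) < \<infinity>"
    "\<And>x r. 0 < r \<Longrightarrow> measure (density lborel (\<lambda>x. ennreal (u x))) (ccube x r) = wmeas v (ccube x r)"
    "AE y in lborel. \<forall>x r. 0 < r \<longrightarrow> infnorm (x - y) \<le> r \<longrightarrow>
       measure (density lborel (\<lambda>x. ennreal (u x))) (ccube x r) \<le> C * r ^ DIM('a) * u y"
proof -
  have w: "weight v" using assms by (simp add: A1_def)
  have v_pos: "AE x in lborel. 0 < v x"
    using w by (simp add: weight_def AE_completion_iff)
  have v_int: "set_integrable lebesgue (ccube x r) v" if "0 < r" for x r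
    using w cube_ccube[OF that, of x] unfolding weight_def loc_int_def by blast
  obtain v' where v' [measurable]: "v' \<in> borel_measurable borel" and v'_eq: "AE x in lborel. v x = v' x"
    using completion_ex_borel_measurable_real[of v lborel] w by (auto simp: weight_def loc_int_def)
  \<comment> \<open>The value 1 on the null set where the Borel version fails to be positive makes
    \<open>u\<close> positive everywhere without changing any integral.\<close>
  define u where "u = (\<lambda>x. if 0 < v' x then v' x else 1)"
  have u [measurable]: "u \<in> borel_measurable borel" unfolding u_def by measurable
  have u_eq: "AE x in lborel. v x = u x"
    using v'_eq v_pos by eventually_elim (simp add: u_def)
  have em: "emeasure (density lborel (\<lambda>x. ennreal (u x))) (ccube x r) = ennreal (wmeas v (ccube x r))"
    if "0 < r" for x r
    unfolding wmeas_def using v_pos v_int[OF that]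
    by (intro emeasure_density_eq_set_integral u u_eq) (auto elim: eventually_mono)
  have fin: "emeasure (density lborel (\<lambda>x. ennreal (u x))) (ccube x r) < \<infinity>" for x r
  proof -
    have "emeasure (density lborel (\<lambda>x. ennreal (u x))) (ccube x r)
        \<le> emeasure (density lborel (\<lambda>x. ennreal (u x))) (ccube x (max r 1))"
      by (intro emeasure_mono ccube_mono_radius) auto
    also have "\<dots> < \<infinity>" by (simp add: em)
    finally show ?thesis .
  qed
  have meas: "measure (density lborel (\<lambda>x. ennreal (u x))) (ccube x r) = wmeas v (ccube x r)"
    if "0 < r" for x r
  proof -
    have "0 \<le> wmeas v (ccube x r)"
      unfolding wmeas_def set_lebesgue_integral_def
      using AE_completion[OF v_pos]
      by (intro integral_nonneg_AE) (auto elim!: eventually_mono)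
    then show ?thesis using em[OF that, of x] by (simp add: measure_def)
  qed
  obtain C where C: "0 < C" "AE y in lebesgue. \<forall>x r. 0 < r \<longrightarrow> infnorm (x - y) \<le> r \<longrightarrow>
    wmeas v (ccube x r) \<le> C * r ^ DIM('a) * v y"
    using A1_pointwise[OF assms] by blast
  have "AE y in lborel. \<forall>x r. 0 < r \<longrightarrow> infnorm (x - y) \<le> r \<longrightarrow>
       measure (density lborel (\<lambda>x. ennreal (u x))) (ccube x r) \<le> C * r ^ DIM('a) * u y"
    using C(2)[unfolded AE_completion_iff] u_eq by eventually_elim (simp add: meas)
  then show thesis
    using u_eq C(1) fin meas by (intro that[of u C] u) (auto simp: u_def)
qed

section \<open>Reduction of the theorem to the potential estimate\<close>

lemma morrey_quot_le_norm:
  assumes "morrey_space p \<kappa> u v f" "cube Q"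
  shows "morrey_quot p \<kappa> u v f Q \<le> morrey_norm p \<kappa> u v f"
  unfolding morrey_norm_def using assms by (intro cSUP_upper) (auto simp: morrey_space_def)

lemma morrey_norm_nonneg:
  assumes "morrey_space p \<kappa> u v f"
  shows "0 \<le> morrey_norm p \<kappa> u v (f :: 'a::euclidean_space \<Rightarrow> real)"
  using morrey_quot_le_norm[OF assms cube_ccube[of 1 0]]
  by (rule order_trans[rotated]) (simp_all add: morrey_quot_def)

theorem theorem2:
  fixes w b :: "'a::euclidean_space \<Rightarrow> real"
    and \<alpha> \<beta> p s \<kappa> c :: real
  defines "n \<equiv> real DIM('a)"
  assumes "0 < \<beta>" "\<beta> < 1"
    and "0 < \<alpha>" "\<alpha> < n" "\<alpha> + \<beta> < n"
    and "1 < p" "p < n / (\<alpha> + \<beta>)"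
    and "1 / s = 1 / p - (\<alpha> + \<beta>) / n"
    and "0 < \<kappa>" "\<kappa> < min (p / s) (p * \<beta> / n)"
    and "weight w" "A1 (\<lambda>x. w x powr s)"
    and "0 < c"
    and "lip_space \<beta> b"
  shows "\<exists>C. \<forall>f. morrey_space p \<kappa> (\<lambda>x. w x powr p) (\<lambda>x. w x powr s) f \<longrightarrow>
     morrey_space s (\<kappa> * s / p) (\<lambda>x. w x powr s) (\<lambda>x. w x powr s) (commutator b c \<alpha> f) \<and>
     morrey_norm s (\<kappa> * s / p) (\<lambda>x. w x powr s) (\<lambda>x. w x powr s) (commutator b c \<alpha> f)
       \<le> C * lip_norm \<beta> b * morrey_norm p \<kappa> (\<lambda>x. w x powr p) (\<lambda>x. w x powr s) f"
proof -
  define v where "v = (\<lambda>x. w x powr s)"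
  have n: "0 < n" by (simp add: n_def)
  have s_pos: "0 < s"
  proof -
    have "p * (\<alpha> + \<beta>) < n" using assms by (simp add: pos_less_divide_eq)
    then have "(\<alpha> + \<beta>) / n < 1 / p" using n \<open>1 < p\<close> by (simp add: field_simps)
    then have "0 < 1 / s" using assms by simp
    then show ?thesis by simp
  qed
  have "A1 v" using assms by (simp add: v_def)
  then obtain u C1 where u [measurable]: "u \<in> borel_measurable borel" and u_pos: "\<And>x. 0 < u x"
    and u_eq: "AE x in lborel. v x = u x" and "0 < C1"
    and fin: "\<And>x r. emeasure (density lborel (\<lambda>x. ennreal (u x))) (ccube x r) < \<infinity>"
    and meas: "\<And>x r. 0 < r \<Longrightarrow> measure (density lborel (\<lambda>x. ennreal (u x))) (ccube x r) = wmeas v (ccube x r)"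
    and A1: "AE y in lborel. \<forall>x r. 0 < r \<longrightarrow> infnorm (x - y) \<le> r \<longrightarrow>
       measure (density lborel (\<lambda>x. ennreal (u x))) (ccube x r) \<le> C1 * r ^ DIM('a) * u y"
    by (rule A1_borel_version) blast
  interpret A1_morrey u C1 p s \<kappa> "\<alpha> + \<beta>"
    by unfold_locales (use u u_pos fin \<open>0 < C1\<close> A1 assms s_pos in auto)
  have meas\<mu>: "measure \<mu> (ccube x r) = wmeas v (ccube x r)" if "0 < r" for x r
    using meas[OF that] by (simp add: \<mu>_def)
  have w_pos: "AE x in lborel. 0 < w x"
    using \<open>weight w\<close> by (simp add: weight_def AE_completion_iff)
  have v_meas: "v \<in> borel_measurable lebesgue"
    using \<open>A1 v\<close> by (simp add: A1_def weight_def loc_int_def)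
  have b_meas: "b \<in> borel_measurable lebesgue"
    using \<open>lip_space \<beta> b\<close> by (simp add: lip_space_def loc_int_def)
  define L where "L = lip_norm \<beta> b"
  have L: "0 \<le> L" using lip_norm_nonneg assms by (simp add: L_def)
  obtain A b0 where A: "0 < A" and b0: "AE x in lborel. b x = b0 x"
    "\<And>x y. \<bar>b0 x - b0 y\<bar> \<le> A * L * infnorm (x - y) powr \<beta>"
    using lip_space_Holder[OF \<open>lip_space \<beta> b\<close> \<open>0 < \<beta>\<close>] unfolding L_def by blast
  obtain K where K: "0 < K" and bound: "\<And>F M z R L H. morrey_bound F M \<Longrightarrow> 0 < R \<Longrightarrow> 0 \<le> L \<Longrightarrow>
     (AE x in lborel. ennreal \<bar>H x\<bar> \<le> ennreal L *
        (\<integral>\<^sup>+y. ennreal (F y * infnorm (x - y) powr (\<alpha> + \<beta> - real DIM('a))) \<partial>lborel)) \<Longrightarrow>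
     (\<integral>\<^sup>+x\<in>ccube z R. ennreal (\<bar>H x\<bar> powr s * u x) \<partial>lborel)
       \<le> ennreal (K * L powr s * M powr s * measure \<mu> (ccube z R) powr (\<kappa> * s / p))"
    using riesz_potential_morrey_bound by blast
  \<comment> \<open>The s-th root of the potential constant, the normalisation of the fractional
    integral, and the Hoelder constant of \<open>b0\<close> relative to the Lipschitz norm.\<close>
  define C where "C = K powr (1 / s) * c * A"
  have main: "morrey_space s (\<kappa> * s / p) v v (commutator b c \<alpha> f) \<and>
     morrey_norm s (\<kappa> * s / p) v v (commutator b c \<alpha> f) \<le> C * L * morrey_norm p \<kappa> (\<lambda>x. w x powr p) v f"
    if f: "morrey_space p \<kappa> (\<lambda>x. w x powr p) v f" for f
  proof -
    define N where "N = morrey_norm p \<kappa> (\<lambda>x. w x powr p) v f"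
    have N: "0 \<le> N" using morrey_norm_nonneg[OF f] by (simp add: N_def)
    have f_meas: "f \<in> borel_measurable lebesgue" using f by (simp add: morrey_space_def)
    obtain f' where [measurable]: "f' \<in> borel_measurable borel" and f'_eq: "AE x in lborel. f x = f' x"
      using completion_ex_borel_measurable_real[of f lborel] f_meas by auto
    define F where "F = (\<lambda>y. \<bar>f' y\<bar>)"
    have [measurable]: "F \<in> borel_measurable borel" unfolding F_def by measurable
    define H where "H = commutator b c \<alpha> f"
    have H_meas: "H \<in> borel_measurable lebesgue"
      unfolding H_def by (intro commutator_measurable f_meas b_meas)
    have H_le: "AE x in lborel. ennreal \<bar>H x\<bar> \<le> ennreal (c * (A * L)) *
        (\<integral>\<^sup>+y. ennreal (F y * infnorm (x - y) powr (\<alpha> + \<beta> - real DIM('a))) \<partial>lborel)"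
    proof -
      have "(\<integral>\<^sup>+y. ennreal (\<bar>f y\<bar> * infnorm (x - y) powr (\<alpha> + \<beta> - real DIM('a))) \<partial>lborel)
          = (\<integral>\<^sup>+y. ennreal (F y * infnorm (x - y) powr (\<alpha> + \<beta> - real DIM('a))) \<partial>lborel)" for x
        using f'_eq by (intro nn_integral_cong_AE) (auto elim!: eventually_mono simp: F_def)
      then show ?thesis
        using commutator_pointwise_bound[OF b_meas f_meas b0, of \<alpha> c] A L assms
        by (simp add: H_def)
    qed
    have bound_F: "morrey_bound F M" if M: "0 < M" "N \<le> M" for M
      unfolding morrey_bound_def
    proof (intro conjI allI impI)
      fix x :: 'a and r :: real assume r: "0 < r"
      define I where "I = (LINT y:ccube x r|lebesgue. \<bar>f y\<bar> powr p * w y powr p)"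
      have U: "0 < wmeas v (ccube x r)" using measure_\<mu>_pos[OF r, of x] meas\<mu>[OF r, of x] by simp
      have "0 \<le> I" unfolding I_def set_lebesgue_integral_def by (rule Bochner_Integration.integral_nonneg) simp
      have "emeasure (density lborel (\<lambda>y. ennreal (F y powr p * u y powr (p / s)))) (ccube x r) = ennreal I"
        unfolding I_def
      proof (rule emeasure_density_eq_set_integral)
        show "AE y in lborel. \<bar>f y\<bar> powr p * w y powr p = F y powr p * u y powr (p / s)"
          using f'_eq u_eq w_pos
        proof eventually_elim
          case (elim y)
          then have "u y powr (p / s) = w y powr p"
            using s_pos by (auto simp: v_def powr_powr dest: sym)
          then show ?case using elim by (simp add: F_def)
        qed
        show "set_integrable lebesgue (ccube x r) (\<lambda>y. \<bar>f y\<bar> powr p * w y powr p)"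
          using f cube_ccube[OF r, of x] unfolding morrey_space_def by blast
      qed auto
      also have "I \<le> M powr p * wmeas v (ccube x r) powr \<kappa>"
      proof -
        define q where "q = 1 / wmeas v (ccube x r) powr \<kappa> * I"
        have q: "0 \<le> q" using \<open>0 \<le> I\<close> by (simp add: q_def)
        have "q powr (1 / p) \<le> M"
          using morrey_quot_le_norm[OF f cube_ccube[OF r, of x]] M
          by (simp add: morrey_quot_def q_def I_def N_def)
        then have "(q powr (1 / p)) powr p \<le> M powr p"
          using \<open>1 < p\<close> by (intro powr_mono2) auto
        then have "q \<le> M powr p" using q \<open>1 < p\<close> by (simp add: powr_powr)
        then show ?thesis using U by (simp add: q_def field_simps)
      qed
      finally show "emeasure (density lborel (\<lambda>y. ennreal (F y powr p * u y powr (p / s)))) (ccube x r)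
          \<le> ennreal (M powr p * measure \<mu> (ccube x r) powr \<kappa>)"
        using meas\<mu>[OF r] by (simp add: ennreal_leI)
    qed (use M in \<open>auto simp: F_def\<close>)
    have int_bound: "set_integrable lebesgue (ccube z R) (\<lambda>x. \<bar>H x\<bar> powr s * v x) \<and>
        (LINT x:ccube z R|lebesgue. \<bar>H x\<bar> powr s * v x)
          \<le> K * (c * (A * L)) powr s * M powr s * wmeas v (ccube z R) powr (\<kappa> * s / p)"
      if M: "0 < M" "N \<le> M" and R: "0 < R" for M z R
    proof -
      define X where "X = K * (c * (A * L)) powr s * M powr s * wmeas v (ccube z R) powr (\<kappa> * s / p)"
      have X: "0 \<le> X" using K by (simp add: X_def)
      have v_nonneg: "0 \<le> v x" for x by (simp add: v_def)
      have m [measurable]: "(\<lambda>x. indicator (ccube z R) x *\<^sub>R (\<bar>H x\<bar> powr s * v x)) \<in> borel_measurable lebesgue"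
        using H_meas v_meas
        by (intro borel_measurable_scaleR borel_measurable_times powr_real_measurable
              borel_measurable_abs borel_measurable_indicator) auto
      have "(\<integral>\<^sup>+x. ennreal (indicator (ccube z R) x *\<^sub>R (\<bar>H x\<bar> powr s * v x)) \<partial>lebesgue)
          = (\<integral>\<^sup>+x\<in>ccube z R. ennreal (\<bar>H x\<bar> powr s * u x) \<partial>lborel)"
        unfolding nn_integral_completion using u_eq
        by (intro nn_integral_cong_AE) (auto elim!: eventually_mono simp: indicator_def)
      also have "\<dots> \<le> ennreal X"
        using bound[OF bound_F[OF M] R _ H_le, of z] A L \<open>0 < c\<close>
        by (simp add: X_def meas\<mu>[OF R])
      finally have le: "(\<integral>\<^sup>+x. ennreal (indicator (ccube z R) x *\<^sub>R (\<bar>H x\<bar> powr s * v x)) \<partial>lebesgue) \<le> ennreal X" .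
      \<comment> \<open>Local integrability is part of membership in the target space and has to
        come from the finite extended integral: the Bochner integral of a non-integrable function is
        0, so a bound on it alone would prove nothing.\<close>
      have int: "integrable lebesgue (\<lambda>x. indicator (ccube z R) x *\<^sub>R (\<bar>H x\<bar> powr s * v x))"
        using le v_nonneg by (intro integrableI_nonneg m) (auto simp: less_top[symmetric] top_unique)
      then have "ennreal (LINT x:ccube z R|lebesgue. \<bar>H x\<bar> powr s * v x) \<le> ennreal X"
        unfolding set_lebesgue_integral_def
        using le v_nonneg by (subst nn_integral_eq_integral[symmetric]) auto
      then show ?thesis
        using int X by (simp add: set_integrable_def X_def[symmetric])
    qed
    have quot: "morrey_quot s (\<kappa> * s / p) v v H Q \<le> C * L * N" if Q: "cube Q" for Q
    proof -
      obtain z R where R: "0 < R" "Q = ccube z R" using Q by (rule cube_obtain_ccube)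
      have U: "0 < wmeas v Q" using measure_\<mu>_pos[OF R(1), of z] meas\<mu>[OF R(1), of z] R by simp
      define I where "I = (LINT x:Q|lebesgue. \<bar>H x\<bar> powr s * v x)"
      have "0 \<le> I" unfolding I_def set_lebesgue_integral_def v_def
        by (rule Bochner_Integration.integral_nonneg) simp
      have le: "morrey_quot s (\<kappa> * s / p) v v H Q \<le> C * L * M" if M: "0 < M" "N \<le> M" for M
      proof -
        have "I \<le> K * (c * (A * L)) powr s * M powr s * wmeas v Q powr (\<kappa> * s / p)"
          using int_bound[OF M R(1), of z] by (simp add: I_def R)
        then have "1 / wmeas v Q powr (\<kappa> * s / p) * I \<le> K * (c * (A * L)) powr s * M powr s"
          using U by (simp add: field_simps)
        then have "(1 / wmeas v Q powr (\<kappa> * s / p) * I) powr (1 / s)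
            \<le> (K * (c * (A * L)) powr s * M powr s) powr (1 / s)"
          using s_pos \<open>0 \<le> I\<close> by (intro powr_mono2) auto
        also have "\<dots> = C * L * M"
          using K M s_pos A L \<open>0 < c\<close> by (simp add: powr_mult powr_powr C_def)
        finally show ?thesis by (simp add: morrey_quot_def I_def)
      qed
      have CL: "0 \<le> C * L" using A L \<open>0 < c\<close> by (simp add: C_def)
      show ?thesis
      proof (rule field_le_epsilon)
        fix e :: real assume e: "0 < e"
        \<comment> \<open>The admissible \<open>M\<close> exceeds \<open>N\<close> by this quotient;
          the summand 1 allows C L = 0.\<close>
        have "C * L * (e / (C * L + 1)) \<le> e"
          using e CL by (simp add: field_simps)
        moreover have "0 < e / (C * L + 1)" using e CL by simp
        ultimately show "morrey_quot s (\<kappa> * s / p) v v H Q \<le> C * L * N + e"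
          using le[of "N + e / (C * L + 1)"] N by (simp add: distrib_left)
      qed
    qed
    have "set_integrable lebesgue Q (\<lambda>x. \<bar>H x\<bar> powr s * v x)" if "cube Q" for Q
    proof -
      obtain z R where R: "0 < R" "Q = ccube z R" using \<open>cube Q\<close> by (rule cube_obtain_ccube)
      show ?thesis using int_bound[of "N + 1" R z] R N by simp
    qed
    then have "morrey_space s (\<kappa> * s / p) v v H"
      using quot H_meas unfolding morrey_space_def by (auto intro!: bdd_aboveI2)
    moreover have "morrey_norm s (\<kappa> * s / p) v v H \<le> C * L * N"
      unfolding morrey_norm_def using quot by (intro cSUP_least cubes_nonempty) auto
    ultimately show ?thesis by (simp add: H_def N_def)
  qed
  then show ?thesis unfolding v_def L_def by blast
qed

end
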